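(* Suppose $n>k\ge\lfloor n/2\rfloor$ (with $k\ge1$). Then $$\operatorname{Hdepth}_1M(n,k)=\operatorname{Hdepth}_nM(n,k)=n-1.$$
   Context: $K$ is a field, $R=K[X_1,\dots,X_n]$. $M(n,k)$ is the $k$-th syzygy module of $K=R/(X_1,\dots,X_n)$ in the Koszul complex: the image of $\partial:\bigwedge^kR^n\to\bigwedge^{k-1}R^n$, $\partial(e_{i_1}\wedge\dots\wedge e_{i_k})=\sum_{r=1}^k(-1)^{r+1}X_{i_r}e_{i_1}\wedge\dots\widehat{e_{i_r}}\dots\wedge e_{i_k}$, where $e_{i_1}\wedge\dots\wedge e_{i_k}$ has multidegree $e_{i_1}+\dots+e_{i_k}$ and standard degree $k$. Subscript $n$: multigrading ($\deg X_i=e_i$); subscript $1$: standard grading ($\deg X_i=1$). A graded retract of $R$ is a graded $K$-subalgebra $S$ with a graded $K$-algebra epimorphism $R\to S$ restricting to the identity on $S$. A Hilbert decomposition of $M$ is a finite family $(S_i,s_i)$, $s_i$ degrees, $S_i$ graded retracts, with $M\cong\bigoplus_iS_i(-s_i)$ as graded $K$-vector spaces; its depth is $\min_i\dim S_i$; $\operatorname{Hdepth}M$ is the maximal depth of a Hilbert decomposition in the respective grading. *)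

theory Defs
  imports "HOL-Library.Poly_Mapping" "HOL-Algebra.Ideal"
begin

text \<open>Polynomials over the field 'k in countably many variables X_0, X_1, ...:
  finitely supported maps from monomials (exponent vectors nat =>0 nat) to 'k.
  The variables X_1..X_n of the paper are X_0..X_{n-1} here.\<close>

type_synonym 'k mpoly = "(nat \<Rightarrow>\<^sub>0 nat) \<Rightarrow>\<^sub>0 'k"

definition polyR :: "nat \<Rightarrow> ('k::field) mpoly set" where
  "polyR n = {p. \<forall>m\<in>Poly_Mapping.keys p. Poly_Mapping.keys m \<subseteq> {..<n}}"

definition const :: "'k::field \<Rightarrow> 'k mpoly" where
  "const c = Poly_Mapping.single 0 c"

definition var :: "nat \<Rightarrow> ('k::field) mpoly" where
  "var i = Poly_Mapping.single (Poly_Mapping.single i 1) 1"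

text \<open>A grading is given by the degree of a monomial (deg X_i) and the degree
  of a basis element e_I of the exterior power.\<close>

definition mdeg_multi :: "(nat \<Rightarrow>\<^sub>0 nat) \<Rightarrow> (nat \<Rightarrow>\<^sub>0 int)" where
  "mdeg_multi m = Poly_Mapping.map int m"

definition edeg_multi :: "nat set \<Rightarrow> (nat \<Rightarrow>\<^sub>0 int)" where
  "edeg_multi I = (\<Sum>i\<in>I. Poly_Mapping.single i 1)"

definition mdeg_std :: "(nat \<Rightarrow>\<^sub>0 nat) \<Rightarrow> int" where
  "mdeg_std m = int (\<Sum>i\<in>Poly_Mapping.keys m. Poly_Mapping.lookup m i)"

definition edeg_std :: "nat set \<Rightarrow> int" where
  "edeg_std I = int (card I)"

text \<open>Admissible degrees (degree shifts): Z^n for the multigrading, Z for the standard one.\<close>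
definition degs_multi :: "nat \<Rightarrow> (nat \<Rightarrow>\<^sub>0 int) set" where
  "degs_multi n = {s. Poly_Mapping.keys s \<subseteq> {..<n}}"

definition degs_std :: "int set" where
  "degs_std = UNIV"

text \<open>p is homogeneous of degree d in the shifted module (-s), i.e. every monomial
  m of p satisfies deg m + s = d (0 is homogeneous of every degree).\<close>
definition homog_sh :: "((nat \<Rightarrow>\<^sub>0 nat) \<Rightarrow> 'd::plus) \<Rightarrow> 'd \<Rightarrow> 'd \<Rightarrow> ('k::field) mpoly \<Rightarrow> bool" where
  "homog_sh g s d p \<longleftrightarrow> (\<forall>m\<in>Poly_Mapping.keys p. g m + s = d)"

definition homog :: "((nat \<Rightarrow>\<^sub>0 nat) \<Rightarrow> 'd::monoid_add) \<Rightarrow> 'd \<Rightarrow> ('k::field) mpoly \<Rightarrow> bool" where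
  "homog g d p \<longleftrightarrow> homog_sh g 0 d p"

definition hcomp :: "((nat \<Rightarrow>\<^sub>0 nat) \<Rightarrow> 'd) \<Rightarrow> 'd \<Rightarrow> ('k::field) mpoly \<Rightarrow> 'k mpoly" where
  "hcomp g d p = (\<Sum>m\<in>{m\<in>Poly_Mapping.keys p. g m = d}. Poly_Mapping.single m (Poly_Mapping.lookup p m))"

definition graded_subalgebra :: "((nat \<Rightarrow>\<^sub>0 nat) \<Rightarrow> 'd) \<Rightarrow> nat \<Rightarrow> ('k::field) mpoly set \<Rightarrow> bool" where
  "graded_subalgebra g n S \<longleftrightarrow>
     S \<subseteq> polyR n \<and> (\<forall>c. const c \<in> S) \<and>
     (\<forall>p\<in>S. \<forall>q\<in>S. p + q \<in> S \<and> p * q \<in> S) \<and>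
     (\<forall>p\<in>S. \<forall>d. hcomp g d p \<in> S)"

definition graded_retraction :: "((nat \<Rightarrow>\<^sub>0 nat) \<Rightarrow> 'd::monoid_add) \<Rightarrow> nat \<Rightarrow> ('k::field) mpoly set
    \<Rightarrow> ('k mpoly \<Rightarrow> 'k mpoly) \<Rightarrow> bool" where
  "graded_retraction g n S \<phi> \<longleftrightarrow>
     \<phi> ` polyR n = S \<and>
     (\<forall>p\<in>polyR n. \<forall>q\<in>polyR n. \<phi> (p + q) = \<phi> p + \<phi> q \<and> \<phi> (p * q) = \<phi> p * \<phi> q) \<and>
     (\<forall>c. \<phi> (const c) = const c) \<and>
     (\<forall>p\<in>polyR n. \<forall>d. homog g d p \<longrightarrow> homog g d (\<phi> p)) \<and>
     (\<forall>p\<in>S. \<phi> p = p)"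

definition graded_retract :: "((nat \<Rightarrow>\<^sub>0 nat) \<Rightarrow> 'd::monoid_add) \<Rightarrow> nat \<Rightarrow> ('k::field) mpoly set \<Rightarrow> bool" where
  "graded_retract g n S \<longleftrightarrow> graded_subalgebra g n S \<and> (\<exists>\<phi>. graded_retraction g n S \<phi>)"

definition subring_of :: "('k::field) mpoly set \<Rightarrow> 'k mpoly ring" where
  "subring_of S = \<lparr>carrier = S, monoid.mult = (*), one = 1, zero = 0, add = (+)\<rparr>"

definition krull_dim :: "('k::field) mpoly set \<Rightarrow> nat" where
  "krull_dim S = Sup {d. \<exists>P :: nat \<Rightarrow> 'k mpoly set.
      (\<forall>i\<le>d. primeideal (P i) (subring_of S)) \<and> (\<forall>i<d. P i \<subset> P (Suc i))}"

text \<open>Elements of the k-th exterior power of R^n: coefficient functions on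
  k-subsets I of {0..<n} (coefficient of e_I), with values in R.\<close>
definition wedge :: "nat \<Rightarrow> nat \<Rightarrow> (nat set \<Rightarrow> ('k::field) mpoly) set" where
  "wedge n k = {y. \<forall>I. y I \<in> polyR n \<and> (\<not> (I \<subseteq> {..<n} \<and> card I = k) \<longrightarrow> y I = 0)}"

text \<open>Koszul differential: the coefficient of e_J in the image of
  y = sum y(I) e_I. For i not in J, e_{J+i} contributes (-1)^{#{j in J. j < i}} X_i e_J.\<close>
definition koszul_d :: "nat \<Rightarrow> (nat set \<Rightarrow> ('k::field) mpoly) \<Rightarrow> (nat set \<Rightarrow> 'k mpoly)" where
  "koszul_d n y = (\<lambda>J. \<Sum>i\<in>{..<n} - J.
      const ((-1) ^ card {j\<in>J. j < i}) * var i * y (insert i J))"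

definition Mmod :: "nat \<Rightarrow> nat \<Rightarrow> (nat set \<Rightarrow> ('k::field) mpoly) set" where
  "Mmod n k = koszul_d n ` wedge n k"

definition homM :: "((nat \<Rightarrow>\<^sub>0 nat) \<Rightarrow> 'd::plus) \<Rightarrow> (nat set \<Rightarrow> 'd) \<Rightarrow> 'd
    \<Rightarrow> (nat set \<Rightarrow> ('k::field) mpoly) \<Rightarrow> bool" where
  "homM g e d y \<longleftrightarrow> (\<forall>I. homog_sh g (e I) d (y I))"

text \<open>A family is a list of pairs (S_i, s_i); the direct sum of the S_i(-s_i)
  is represented by functions x with x i in S_i.\<close>
definition dsum :: "(('k::field) mpoly set \<times> 'd) list \<Rightarrow> (nat \<Rightarrow> 'k mpoly) set" where
  "dsum D = {x. (\<forall>i<length D. x i \<in> fst (D ! i)) \<and> (\<forall>i\<ge>length D. x i = 0)}"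

definition homD :: "((nat \<Rightarrow>\<^sub>0 nat) \<Rightarrow> 'd::plus) \<Rightarrow> (('k::field) mpoly set \<times> 'd) list \<Rightarrow> 'd
    \<Rightarrow> (nat \<Rightarrow> 'k mpoly) \<Rightarrow> bool" where
  "homD g D d x \<longleftrightarrow> (\<forall>i<length D. homog_sh g (snd (D ! i)) d (x i))"

definition graded_iso :: "((nat \<Rightarrow>\<^sub>0 nat) \<Rightarrow> 'd::plus) \<Rightarrow> (nat set \<Rightarrow> 'd)
    \<Rightarrow> (nat set \<Rightarrow> ('k::field) mpoly) set \<Rightarrow> ('k mpoly set \<times> 'd) list
    \<Rightarrow> ((nat set \<Rightarrow> 'k mpoly) \<Rightarrow> (nat \<Rightarrow> 'k mpoly)) \<Rightarrow> bool" where
  "graded_iso g e M D f \<longleftrightarrow>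
     bij_betw f M (dsum D) \<and>
     (\<forall>a\<in>M. \<forall>b\<in>M. f (\<lambda>I. a I + b I) = (\<lambda>i. f a i + f b i)) \<and>
     (\<forall>a\<in>M. \<forall>c. f (\<lambda>I. const c * a I) = (\<lambda>i. const c * f a i)) \<and>
     (\<forall>a\<in>M. \<forall>d. homM g e d a \<longleftrightarrow> homD g D d (f a))"

definition hilbert_decomp :: "((nat \<Rightarrow>\<^sub>0 nat) \<Rightarrow> 'd::monoid_add) \<Rightarrow> (nat set \<Rightarrow> 'd) \<Rightarrow> 'd set
    \<Rightarrow> nat \<Rightarrow> (nat set \<Rightarrow> ('k::field) mpoly) set \<Rightarrow> ('k mpoly set \<times> 'd) list \<Rightarrow> bool" where
  "hilbert_decomp g e Deg n M D \<longleftrightarrow>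
     (\<forall>(S, s)\<in>set D. graded_retract g n S \<and> s \<in> Deg) \<and> (\<exists>f. graded_iso g e M D f)"

definition decomp_depth :: "(('k::field) mpoly set \<times> 'd) list \<Rightarrow> nat" where
  "decomp_depth D = Min ((\<lambda>(S, s). krull_dim S) ` set D)"

definition Hdepth :: "((nat \<Rightarrow>\<^sub>0 nat) \<Rightarrow> 'd::monoid_add) \<Rightarrow> (nat set \<Rightarrow> 'd) \<Rightarrow> 'd set
    \<Rightarrow> nat \<Rightarrow> (nat set \<Rightarrow> ('k::field) mpoly) set \<Rightarrow> nat" where
  "Hdepth g e Deg n M = (GREATEST t. \<exists>D. hilbert_decomp g e Deg n M D \<and> decomp_depth D = t)"

abbreviation Hdepth_std :: "nat \<Rightarrow> (nat set \<Rightarrow> ('k::field) mpoly) set \<Rightarrow> nat" where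
  "Hdepth_std n M \<equiv> Hdepth mdeg_std edeg_std degs_std n M"

abbreviation Hdepth_multi :: "nat \<Rightarrow> (nat set \<Rightarrow> ('k::field) mpoly) set \<Rightarrow> nat" where
  "Hdepth_multi n M \<equiv> Hdepth mdeg_multi edeg_multi (degs_multi n) n M"

end

theory Submission
  imports Defs "HOL.Vector_Spaces"
begin

text \<open>
  The Koszul relations show that the elements \<open>X\<^sup>m \<cdot> \<partial> e\<^sub>I\<close> with \<open>card I = k\<close> and
  \<open>min I \<le> min (supp m)\<close> form a multigraded vector space basis of \<open>M(n, k)\<close>. Only degrees of
  basis elements matter for Hilbert decompositions.

  Lower bound: in the Grothendieck group, \<open>M(n, k)\<close> is the alternating sum of the exterior powers
  \<open>\<Lambda>\<^sup>j\<close>, \<open>j \<ge> k\<close>. For \<open>2 (j + 1) > n\<close> the \<open>(j + 1)\<close>-subsets can be matched injectively to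
  \<open>j\<close>-subsets contained in them, and \<open>R(-e\<^sub>B) - R(-e\<^sub>B - e\<^sub>i) = (R / X\<^sub>i)(-e\<^sub>B)\<close>, so each difference
  \<open>\<Lambda>\<^sup>j - \<Lambda>\<^bsup>j+1\<^esup>\<close> with \<open>j - k\<close> even becomes a sum of polynomial rings in at least \<open>n - 1\<close>
  variables.

  Upper bound: a proper graded retract of \<open>R\<close> is generated by \<open>n - 1\<close> elements and hence has Krull
  dimension at most \<open>n - 1\<close>, so a decomposition of depth \<open>n\<close> would consist of shifted copies of
  \<open>R\<close>; this contradicts the dimensions of \<open>M(n, k)\<close> in degrees \<open>k\<close> and \<open>k + 1\<close>.
\<close>

text \<open>Both bounds are reduced to counting. Graded vector spaces are isomorphic as soon as they
  have homogeneous bases with a degree-preserving bijection between them, so the lower bound becomes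
  an identity between numbers of subsets in each multidegree, valid for every grading that the
  Koszul differential respects. The bound on k enters through j + 1 \<ge> k + 1 > n / 2, the range
  where removing one element maps sets injectively to smaller sets; injectivity is what limits the
  loss to one variable per summand. The obstacle in the upper bound is that a retract for the
  standard grading need not be generated by some of the variables, so its Krull dimension has to be
  bounded from generators alone. Elements chosen along a chain of primes are algebraically
  independent, and they cannot outnumber the generators: the monomials in them would grow faster
  than the spans that contain them.\<close>

abbreviation lookup :: "('a \<Rightarrow>\<^sub>0 'b::zero) \<Rightarrow> 'a \<Rightarrow> 'b" where "lookup \<equiv> Poly_Mapping.lookup"
abbreviation keys :: "('a \<Rightarrow>\<^sub>0 'b::zero) \<Rightarrow> 'a set" where "keys \<equiv> Poly_Mapping.keys"
abbreviation single :: "'a \<Rightarrow> 'b \<Rightarrow> 'a \<Rightarrow>\<^sub>0 'b::zero" where "single \<equiv> Poly_Mapping.single"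

section \<open>Polynomials\<close>

lemma keys_plus_nat: "keys (m + m') = keys m \<union> keys m'" for m m' :: "'a \<Rightarrow>\<^sub>0 nat"
  by (auto simp: in_keys_iff lookup_add)

lemma poly_mapping_sum_singles: "(\<Sum>m\<in>keys p. single m (lookup p m)) = p"
  for p :: "'a \<Rightarrow>\<^sub>0 'b::comm_monoid_add"
  by (rule poly_mapping_eqI)
    (auto simp: lookup_sum lookup_single when_def in_keys_iff sum.delta'[OF finite_keys])

lemma poly_mapping_induct [case_names zero single add]:
  fixes p :: "'a \<Rightarrow>\<^sub>0 'b::comm_monoid_add"
  assumes "P 0" "\<And>m c. P (single m c)" "\<And>p q. P p \<Longrightarrow> P q \<Longrightarrow> P (p + q)"
  shows "P p"
proof -
  have "P (\<Sum>m\<in>A. single m (lookup p m))" if "finite A" for A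
    using that by induction (auto intro: assms)
  from this[of "keys p"] show ?thesis by (simp add: poly_mapping_sum_singles)
qed

lemma lookup_single_mult:
  fixes p :: "'a::cancel_comm_monoid_add \<Rightarrow>\<^sub>0 'b::semiring_0"
  shows "lookup (single m c * p) (m + u) = c * lookup p u"
  by (simp add: lookup_mult lookup_single when_mult)

lemma lookup_single_mult_eq_0:
  fixes p :: "'a::cancel_comm_monoid_add \<Rightarrow>\<^sub>0 'b::semiring_0"
  assumes "\<And>v. u \<noteq> m + v"
  shows "lookup (single m c * p) u = 0"
  using assms by (simp add: lookup_mult lookup_single when_mult)

lemma lookup_const_mult [simp]: "lookup (const c * p) u = c * lookup p u"
  using lookup_single_mult[of 0 c p u] by (simp add: const_def)

lemma const_0 [simp]: "const 0 = 0"
  by (simp add: const_def)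

lemma const_1 [simp]: "const 1 = 1"
  by (simp add: const_def)

lemma const_mult: "const (a * b) = const a * const b"
  by (simp add: const_def mult_single)

lemma const_add: "const (a + b) = const a + const b"
  by (simp add: const_def single_add)

lemma const_uminus: "const (- a) = - const a"
  by (simp add: const_def single_uminus)

lemma single_eq_const_mult: "single m c = const c * single m 1"
  by (simp add: const_def mult_single)

lemma single_1_neq_0: "single m (1::'b::zero_neq_one) \<noteq> 0"
  using lookup_single_eq[of m "1::'b"] by force

lemma const_var_mult: "const c * var i * p = single (single i 1) c * p"
  by (simp add: const_def var_def mult_single)

definition ppoly :: "nat set \<Rightarrow> ('k::field) mpoly set" where
  "ppoly Z = {p. \<forall>m\<in>keys p. keys m \<subseteq> Z}"

lemma polyR_eq_ppoly: "polyR n = ppoly {..<n}"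
  by (simp add: polyR_def ppoly_def)

text \<open>The substitution of 0 for all variables outside \<open>Z\<close>. It serves as the
  retraction onto \<open>ppoly Z\<close>, as a membership test, and through its kernels as a source
  of prime ideals.\<close>

definition restr :: "nat set \<Rightarrow> ('k::field) mpoly \<Rightarrow> 'k mpoly" where
  "restr Z p = Abs_poly_mapping (\<lambda>m. if keys m \<subseteq> Z then lookup p m else 0)"

lemma lookup_restr: "lookup (restr Z p) m = (if keys m \<subseteq> Z then lookup p m else 0)"
proof -
  have "finite {m. (if keys m \<subseteq> Z then lookup p m else 0) \<noteq> 0}"
    by (rule finite_subset[OF _ finite_keys[of p]]) (auto simp: in_keys_iff)
  then show ?thesis by (simp add: restr_def)
qed

lemma restr_add: "restr Z (p + q) = restr Z p + restr Z q"
  by (rule poly_mapping_eqI) (simp add: lookup_restr lookup_add)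

lemma restr_0 [simp]: "restr Z 0 = 0"
  by (rule poly_mapping_eqI) (simp add: lookup_restr)

lemma restr_uminus: "restr Z (- p) = - restr Z p"
  by (rule poly_mapping_eqI) (simp add: lookup_restr)

lemma restr_single: "restr Z (single m c) = (if keys m \<subseteq> Z then single m c else 0)"
  by (rule poly_mapping_eqI) (simp add: lookup_restr lookup_single when_def)

lemma restr_mult: "restr Z (p * q) = restr Z p * restr Z q"
proof (induction p rule: poly_mapping_induct)
  case (single m c)
  show ?case
  proof (induction q rule: poly_mapping_induct)
    case (single m' c')
    then show ?case by (simp add: mult_single restr_single keys_plus_nat)
  qed (simp_all add: distrib_left restr_add)
qed (simp_all add: distrib_right restr_add)

lemma keys_restr_eq: "keys (restr Z p) = {m \<in> keys p. keys m \<subseteq> Z}"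
  by (rule Set.set_eqI)
    (simp add: in_keys_iff[of _ p] in_keys_iff[of _ "restr Z p"] lookup_restr)

lemma restr_in_ppoly: "restr Z p \<in> ppoly Z"
  by (auto simp: ppoly_def keys_restr_eq)

lemma restr_id: "p \<in> ppoly Z \<Longrightarrow> restr Z p = p"
  by (rule poly_mapping_eqI) (auto simp: lookup_restr ppoly_def in_keys_iff)

lemma ppoly_iff: "p \<in> ppoly Z \<longleftrightarrow> restr Z p = p"
  by (metis restr_id restr_in_ppoly)

lemma ppoly_add: "p \<in> ppoly Z \<Longrightarrow> q \<in> ppoly Z \<Longrightarrow> p + q \<in> ppoly Z"
  by (simp add: ppoly_iff restr_add)

lemma ppoly_mult: "p \<in> ppoly Z \<Longrightarrow> q \<in> ppoly Z \<Longrightarrow> p * q \<in> ppoly Z"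
  by (simp add: ppoly_iff restr_mult)

lemma ppoly_uminus: "p \<in> ppoly Z \<Longrightarrow> - p \<in> ppoly Z"
  by (simp add: ppoly_iff restr_uminus)

lemma ppoly_0: "0 \<in> ppoly Z"
  by (simp add: ppoly_def)

lemma ppoly_const: "const c \<in> ppoly Z"
  by (simp add: ppoly_def const_def)

lemma ppoly_1: "1 \<in> ppoly Z"
  using ppoly_const[of 1] by simp

lemma ppoly_single: "keys m \<subseteq> Z \<Longrightarrow> single m c \<in> ppoly Z"
  by (simp add: ppoly_def)

lemma ppoly_var: "i \<in> Z \<Longrightarrow> var i \<in> ppoly Z"
  by (simp add: var_def ppoly_single)

lemma ppoly_sum: "(\<And>i. i \<in> A \<Longrightarrow> p i \<in> ppoly Z) \<Longrightarrow> sum p A \<in> ppoly Z"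
  by (induction A rule: infinite_finite_induct) (auto simp: ppoly_0 ppoly_add)

lemma ppoly_mono: "Z \<subseteq> W \<Longrightarrow> ppoly Z \<subseteq> ppoly W"
  by (auto simp: ppoly_def)

lemma lookup_hcomp: "lookup (hcomp g d p) m = (if g m = d then lookup p m else 0)"
proof -
  have "lookup (hcomp g d p) m
      = (\<Sum>m'\<in>{m'\<in>keys p. g m' = d}. if m' = m then lookup p m' else 0)"
    by (simp add: hcomp_def lookup_sum lookup_single when_def)
  also have "\<dots> = (if g m = d then lookup p m else 0)"
    by (subst sum.delta) (auto simp: in_keys_iff)
  finally show ?thesis .
qed

text \<open>\<open>restr Z\<close> only deletes monomials, so it respects degrees for any degree map
  \<open>g\<close>.\<close>

lemma graded_retract_ppoly:
  assumes "Z \<subseteq> {..<n}"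
  shows "graded_retract g n (ppoly Z :: ('k::field) mpoly set)"
proof -
  have "graded_subalgebra g n (ppoly Z :: 'k mpoly set)"
    using ppoly_mono[OF assms]
    by (auto simp: graded_subalgebra_def polyR_eq_ppoly ppoly_const ppoly_add ppoly_mult)
      (auto simp: ppoly_def in_keys_iff lookup_hcomp split: if_splits)
  moreover have "restr Z ` ppoly {..<n} = (ppoly Z :: 'k mpoly set)"
    using ppoly_mono[OF assms] restr_in_ppoly[of Z] restr_id[of _ Z] by (force simp: image_iff)
  then have "graded_retraction g n (ppoly Z :: 'k mpoly set) (restr Z)"
    by (auto simp: keys_restr_eq graded_retraction_def polyR_eq_ppoly restr_add restr_mult restr_id ppoly_const
        homog_def homog_sh_def)
  ultimately show ?thesis by (auto simp: graded_retract_def)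
qed

section \<open>Linear algebra\<close>

text \<open>Gaussian elimination with equations \<open>B\<close> and unknowns \<open>u\<close>. It
  supplies the linear algebra both for bounding prime chains and for comparing dimensions of graded
  pieces.\<close>

lemma homogeneous_system_nontrivial_solution:
  fixes c :: "'a \<Rightarrow> 'b \<Rightarrow> 'k::field"
  assumes "finite B" "finite A" "card B < card A"
  shows "\<exists>u. (\<exists>a\<in>A. u a \<noteq> 0) \<and> (\<forall>b\<in>B. (\<Sum>a\<in>A. u a * c a b) = 0)"
  using assms
proof (induction B arbitrary: A c)
  case empty
  then obtain a where "a \<in> A" by fastforce
  then show ?case by (intro exI[of _ "\<lambda>_. 1"]) auto
next
  case (insert b B)
  show ?case
  proof (cases "\<forall>a\<in>A. c a b = 0")
    case True
    obtain u where "\<exists>a\<in>A. u a \<noteq> 0" "\<forall>b\<in>B. (\<Sum>a\<in>A. u a * c a b) = 0"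
      using insert.IH[of A c] insert.prems insert.hyps by auto
    with True show ?thesis by (intro exI[of _ u]) auto
  next
    case False
    then obtain a0 where a0: "a0 \<in> A" "c a0 b \<noteq> 0" by auto
    \<comment> \<open>The remaining equations once equation \<open>b\<close> has been solved for the
      unknown \<open>a0\<close>.\<close>
    define c' where "c' a b' = c a b' - c a b / c a0 b * c a0 b'" for a b'
    let ?A = "A - {a0}"
    have "card B < card ?A" using insert.prems insert.hyps a0 by (simp add: card_Diff_singleton)
    from insert.IH[OF _ this, of c'] insert.prems obtain u where
      u: "\<exists>a\<in>?A. u a \<noteq> 0" "\<forall>b'\<in>B. (\<Sum>a\<in>?A. u a * c' a b') = 0" by auto
    \<comment> \<open>The value of the unknown \<open>a0\<close> that equation \<open>b\<close>
      forces.\<close>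
    define t where "t = - (\<Sum>a\<in>?A. u a * c a b) / c a0 b"
    define w where "w = u(a0 := t)"
    have sum_w: "(\<Sum>a\<in>A. w a * c a b') = t * c a0 b' + (\<Sum>a\<in>?A. u a * c a b')" for b'
      using insert.prems a0(1) by (subst sum.remove[of A a0]) (auto simp: w_def intro!: sum.cong)
    have "(\<Sum>a\<in>A. w a * c a b) = 0" using a0 by (simp add: sum_w t_def)
    moreover have "(\<Sum>a\<in>A. w a * c a b') = 0" if "b' \<in> B" for b'
    proof -
      have "0 = (\<Sum>a\<in>?A. u a * c' a b')" using u that by simp
      also have "\<dots> = (\<Sum>a\<in>?A. u a * c a b') - (\<Sum>a\<in>?A. u a * c a b) * (c a0 b' / c a0 b)"
        by (simp only: c'_def right_diff_distrib sum_subtractf sum_distrib_right) (simp add: mult_ac)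
      also have "\<dots> = (\<Sum>a\<in>A. w a * c a b')"
        using a0 by (simp add: sum_w t_def field_simps)
      finally show ?thesis by simp
    qed
    moreover have "\<exists>a\<in>A. w a \<noteq> 0" using u(1) by (auto simp: w_def)
    ultimately show ?thesis by (intro exI[of _ w]) auto
  qed
qed

section \<open>Krull dimension\<close>

lemma cring_subring_of:
  assumes add: "\<And>p q. p \<in> S \<Longrightarrow> q \<in> S \<Longrightarrow> p + q \<in> S"
    and mult: "\<And>p q. p \<in> S \<Longrightarrow> q \<in> S \<Longrightarrow> p * q \<in> S"
    and uminus: "\<And>p. p \<in> S \<Longrightarrow> - p \<in> S"
    and zero: "0 \<in> S" and one: "1 \<in> S"
  shows "cring (subring_of S)"
proof (rule cringI)
  show "abelian_group (subring_of S)"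
  proof (rule abelian_groupI)
    fix x assume "x \<in> carrier (subring_of S)"
    then show "\<exists>y\<in>carrier (subring_of S). y \<oplus>\<^bsub>subring_of S\<^esub> x = \<zero>\<^bsub>subring_of S\<^esub>"
      by (intro bexI[of _ "- x"]) (auto simp: subring_of_def uminus)
  qed (auto simp: subring_of_def add zero algebra_simps)
  show "comm_monoid (subring_of S)"
    by (rule comm_monoidI) (auto simp: subring_of_def mult one algebra_simps)
qed (auto simp: subring_of_def algebra_simps)

lemma primeideal_subring_ofI:
  assumes add: "\<And>p q. p \<in> S \<Longrightarrow> q \<in> S \<Longrightarrow> p + q \<in> S"
    and mult: "\<And>p q. p \<in> S \<Longrightarrow> q \<in> S \<Longrightarrow> p * q \<in> S"
    and uminus: "\<And>p. p \<in> S \<Longrightarrow> - p \<in> S"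
    and zero: "0 \<in> S" and one: "1 \<in> S"
    and "P \<subseteq> S" "0 \<in> P" "1 \<notin> P"
    and "\<And>p q. p \<in> P \<Longrightarrow> q \<in> P \<Longrightarrow> p + q \<in> P"
    and "\<And>p. p \<in> P \<Longrightarrow> - p \<in> P"
    and "\<And>p q. p \<in> S \<Longrightarrow> q \<in> P \<Longrightarrow> p * q \<in> P"
    and "\<And>p q. p \<in> S \<Longrightarrow> q \<in> S \<Longrightarrow> p * q \<in> P \<Longrightarrow> p \<in> P \<or> q \<in> P"
  shows "primeideal P (subring_of S)"
proof (rule primeidealI)
  interpret R: cring "subring_of S"
    using add mult uminus zero one by (rule cring_subring_of)
  show "cring (subring_of S)" ..
  have minus: "\<ominus>\<^bsub>subring_of S\<^esub> p = - p" if "p \<in> S" for p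
    by (rule R.minus_equality) (auto simp: subring_of_def uminus that)
  have P_mult: "p * q \<in> P" if "p \<in> P" "q \<in> S" for p q
    using assms(11)[of q p] that by (simp add: mult.commute)
  show "ideal P (subring_of S)"
  proof (rule idealI)
    show "ring (subring_of S)" ..
    show "subgroup P (add_monoid (subring_of S))"
    proof
      fix x assume "x \<in> P"
      then show "inv\<^bsub>add_monoid (subring_of S)\<^esub> x \<in> P"
        using minus[of x] assms by (auto simp: a_inv_def)
    qed (use assms in \<open>auto simp: subring_of_def\<close>)
  qed (use assms P_mult in \<open>auto simp: subring_of_def\<close>)
qed (use assms in \<open>auto simp: subring_of_def\<close>)

lemma primeideal_subring_ofD:
  assumes "primeideal P (subring_of S)"
  shows "P \<subseteq> S" "P \<noteq> S" "0 \<in> P" "1 \<in> S"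
    and "p \<in> P \<Longrightarrow> q \<in> P \<Longrightarrow> p + q \<in> P"
    and "a \<in> S \<Longrightarrow> p \<in> P \<Longrightarrow> a * p \<in> P"
    and "a \<in> S \<Longrightarrow> b \<in> S \<Longrightarrow> a * b \<in> P \<Longrightarrow> a \<in> P \<or> b \<in> P"
    and "a \<in> S \<Longrightarrow> b \<in> S \<Longrightarrow> a + b \<in> S"
    and "a \<in> S \<Longrightarrow> b \<in> S \<Longrightarrow> a * b \<in> S"
proof -
  interpret primeideal P "subring_of S" by fact
  show "P \<subseteq> S" using a_subset by (simp add: subring_of_def)
  show "P \<noteq> S" using I_notcarr by (auto simp: subring_of_def)
  show "0 \<in> P" using additive_subgroup.zero_closed[OF is_additive_subgroup] by (simp add: subring_of_def)
  show "1 \<in> S" using one_closed by (simp add: subring_of_def)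
  show "p + q \<in> P" if "p \<in> P" "q \<in> P" using additive_subgroup.a_closed[OF is_additive_subgroup that] by (simp add: subring_of_def)
  show "a * p \<in> P" if "a \<in> S" "p \<in> P" using I_l_closed[of p a] that by (simp add: subring_of_def)
  show "a \<in> P \<or> b \<in> P" if "a \<in> S" "b \<in> S" "a * b \<in> P"
    using I_prime[of a b] that by (simp add: subring_of_def)
  show "a + b \<in> S" if "a \<in> S" "b \<in> S"
    using add.m_closed[of a b] that by (simp add: subring_of_def)
  show "a * b \<in> S" if "a \<in> S" "b \<in> S"
    using m_closed[of a b] that by (simp add: subring_of_def)
qed

text \<open>A coordinate flag: each step sets one more variable to zero. \<open>P i\<close> is the
  kernel of a ring map into a domain, hence prime, and the variable \<open>var (h i)\<close> that
  dies in step \<open>i\<close> makes the inclusion strict.\<close>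

lemma ppoly_prime_chain:
  assumes "finite Z"
  shows "\<exists>P. (\<forall>i\<le>card Z. primeideal (P i) (subring_of (ppoly Z :: ('k::field) mpoly set)))
    \<and> (\<forall>i<card Z. P i \<subset> P (Suc i))"
proof -
  obtain h where h: "bij_betw h {0..<card Z} Z" using assms ex_bij_betw_nat_finite by blast
  define W where "W i = h ` {i..<card Z}" for i
  define P where "P i = {p \<in> (ppoly Z :: 'k mpoly set). restr (W i) p = 0}" for i
  have "primeideal (P i) (subring_of (ppoly Z))" for i
  proof (rule primeideal_subring_ofI)
    have "restr (W i) (1 :: 'k mpoly) = 1" using restr_id ppoly_1 by blast
    then show "1 \<notin> P i" by (simp add: P_def)
  qed (auto simp: P_def ppoly_add ppoly_mult ppoly_uminus ppoly_0 ppoly_1 restr_add restr_mult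
      restr_uminus)
  moreover have "P i \<subset> P (Suc i)" if "i < card Z" for i
  proof -
    have W: "W (Suc i) \<subseteq> W i" by (auto simp: W_def)
    have "restr (W (Suc i)) p = 0" if "restr (W i) p = 0" for p :: "'k mpoly"
    proof (rule poly_mapping_eqI)
      fix m
      show "lookup (restr (W (Suc i)) p) m = lookup 0 m"
        using W arg_cong[OF that, of "\<lambda>q. lookup q m"] by (auto simp: lookup_restr split: if_splits)
    qed
    then have "P i \<subseteq> P (Suc i)" by (auto simp: P_def)
    have "h i \<in> W i" "h i \<in> Z" using that h by (auto simp: W_def bij_betw_def)
    moreover have "h i \<notin> W (Suc i)"
      using bij_betw_imp_inj_on[OF h] that unfolding W_def by (auto dest: inj_onD)
    ultimately have "var (h i) \<in> P (Suc i)" "var (h i) \<notin> P i"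
      by (auto simp: P_def ppoly_var) (auto simp: var_def restr_single single_1_neq_0)
    with \<open>P i \<subseteq> P (Suc i)\<close> show ?thesis by blast
  qed
  ultimately show ?thesis by blast
qed

section \<open>Algebras with finitely many generators, filtered by bounds on exponents\<close>

interpretation mpoly: vector_space "\<lambda>c p. const c * (p :: ('k::field) mpoly)"
  by unfold_locales (simp_all add: const_add const_mult algebra_simps)

lemma span_mult:
  assumes "p \<in> mpoly.span B" "q \<in> mpoly.span C" "\<And>b c. b \<in> B \<Longrightarrow> c \<in> C \<Longrightarrow> b * c \<in> mpoly.span T"
  shows "p * q \<in> mpoly.span T"
  using assms(1)
proof (induction p rule: mpoly.span_induct_alt)
  case base
  then show ?case by (simp add: mpoly.span_zero)
next
  case (step a b p)
  from assms(2) have "b * q \<in> mpoly.span T"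
  proof (induction q rule: mpoly.span_induct_alt)
    case base
    then show ?case by (simp add: mpoly.span_zero)
  next
    case (step e c q)
    then have "const e * (b * c) + b * q \<in> mpoly.span T"
      using assms(3)[OF \<open>b \<in> B\<close>] by (intro mpoly.span_add mpoly.span_scale) auto
    then show ?case by (simp add: algebra_simps)
  qed
  then have "const a * (b * q) + p * q \<in> mpoly.span T"
    using step by (intro mpoly.span_add mpoly.span_scale) auto
  then show ?case by (simp add: algebra_simps)
qed

text \<open>Bounding each exponent separately, rather than the total degree, gives the count of at
  most \<open>(E + 1) ^ card G\<close> at once, and boxes with bounds \<open>E\<close> and
  \<open>F\<close> multiply into the box with bound \<open>E + F\<close>.\<close>

definition monom_box :: "('i \<Rightarrow> ('k::field) mpoly) \<Rightarrow> 'i set \<Rightarrow> nat \<Rightarrow> 'k mpoly set" where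
  "monom_box y G E = (\<lambda>b. \<Prod>i\<in>G. y i ^ b i) ` (G \<rightarrow>\<^sub>E {..E})"

lemma finite_monom_box: "finite G \<Longrightarrow> finite (monom_box y G E)"
  by (simp add: monom_box_def finite_PiE)

lemma card_monom_box: "finite G \<Longrightarrow> card (monom_box y G E) \<le> (E + 1) ^ card G"
  unfolding monom_box_def
  using card_image_le[OF finite_PiE, of G "\<lambda>_. {..E}" "\<lambda>b. \<Prod>i\<in>G. y i ^ b i"]
  by (simp add: card_PiE)

lemma monom_box_I:
  assumes "\<And>i. i \<in> G \<Longrightarrow> b i \<le> E"
  shows "(\<Prod>i\<in>G. y i ^ b i) \<in> monom_box y G E"
  unfolding monom_box_def
  by (rule image_eqI[of _ _ "restrict b G"]) (auto simp: assms intro!: prod.cong)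

lemma span_monom_box_mult:
  assumes "p \<in> mpoly.span (monom_box y G E)" "q \<in> mpoly.span (monom_box y G F)"
  shows "p * q \<in> mpoly.span (monom_box y G (E + F))"
proof (rule span_mult[OF assms])
  fix b c assume "b \<in> monom_box y G E" "c \<in> monom_box y G F"
  then obtain s t where st: "s \<in> G \<rightarrow>\<^sub>E {..E}" "t \<in> G \<rightarrow>\<^sub>E {..F}"
      "b = (\<Prod>i\<in>G. y i ^ s i)" "c = (\<Prod>i\<in>G. y i ^ t i)"
    by (auto simp: monom_box_def)
  have "b * c = (\<Prod>i\<in>G. y i ^ (s i + t i))" by (simp add: st power_add prod.distrib)
  also have "\<dots> \<in> monom_box y G (E + F)" using st(1,2) by (intro monom_box_I add_mono) auto
  finally show "b * c \<in> mpoly.span (monom_box y G (E + F))" by (rule mpoly.span_base)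
qed

lemma span_monom_box_mono:
  assumes "p \<in> mpoly.span (monom_box y G E)" "E \<le> F"
  shows "p \<in> mpoly.span (monom_box y G F)"
proof -
  have "G \<rightarrow>\<^sub>E {..E} \<subseteq> G \<rightarrow>\<^sub>E {..F}" using assms(2) by (intro PiE_mono) auto
  then have "monom_box y G E \<subseteq> monom_box y G F" by (auto simp: monom_box_def)
  then show ?thesis using assms(1) mpoly.span_mono by blast
qed

lemma span_monom_box_1: "1 \<in> mpoly.span (monom_box y G 0)"
  using mpoly.span_base[OF monom_box_I[of G "\<lambda>_. 0" 0 y]] by simp

lemma span_monom_box_power:
  "p \<in> mpoly.span (monom_box y G E) \<Longrightarrow> p ^ t \<in> mpoly.span (monom_box y G (t * E))"
  by (induction t) (simp_all add: span_monom_box_1 span_monom_box_mult)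

lemma span_monom_box_prod:
  assumes "finite A" "\<And>i. i \<in> A \<Longrightarrow> p i \<in> mpoly.span (monom_box y G (E i))"
  shows "(\<Prod>i\<in>A. p i) \<in> mpoly.span (monom_box y G (\<Sum>i\<in>A. E i))"
  using assms by (induction A) (simp_all add: span_monom_box_1 span_monom_box_mult)

text \<open>The subalgebra generated by the \<open>y i\<close>, written as an increasing union so
  that every element comes with an exponent bound.\<close>

definition alg_gen :: "('i \<Rightarrow> ('k::field) mpoly) \<Rightarrow> 'i set \<Rightarrow> 'k mpoly set" where
  "alg_gen y G = (\<Union>E. mpoly.span (monom_box y G E))"

lemma alg_gen_add: "p \<in> alg_gen y G \<Longrightarrow> q \<in> alg_gen y G \<Longrightarrow> p + q \<in> alg_gen y G"
proof -
  assume "p \<in> alg_gen y G" "q \<in> alg_gen y G"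
  then obtain E F where "p \<in> mpoly.span (monom_box y G E)" "q \<in> mpoly.span (monom_box y G F)"
    unfolding alg_gen_def by blast
  then have "p \<in> mpoly.span (monom_box y G (E + F))" "q \<in> mpoly.span (monom_box y G (E + F))"
    using span_monom_box_mono le_add1 le_add2 by blast+
  then have "p + q \<in> mpoly.span (monom_box y G (E + F))" by (rule mpoly.span_add)
  then show ?thesis unfolding alg_gen_def by blast
qed

lemma alg_gen_mult: "p \<in> alg_gen y G \<Longrightarrow> q \<in> alg_gen y G \<Longrightarrow> p * q \<in> alg_gen y G"
proof -
  assume "p \<in> alg_gen y G" "q \<in> alg_gen y G"
  then obtain E F where "p \<in> mpoly.span (monom_box y G E)" "q \<in> mpoly.span (monom_box y G F)"
    unfolding alg_gen_def by blast
  then have "p * q \<in> mpoly.span (monom_box y G (E + F))" by (rule span_monom_box_mult)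
  then show ?thesis unfolding alg_gen_def by blast
qed

lemma alg_gen_const: "const c \<in> alg_gen y G"
  unfolding alg_gen_def
  using mpoly.span_scale[OF span_monom_box_1, of c] by auto

lemma alg_gen_0: "0 \<in> alg_gen y G"
  using alg_gen_const[of 0] by simp

lemma alg_gen_1: "1 \<in> alg_gen y G"
  using alg_gen_const[of 1] by simp

lemma alg_gen_sum: "(\<And>i. i \<in> A \<Longrightarrow> p i \<in> alg_gen y G) \<Longrightarrow> sum p A \<in> alg_gen y G"
  by (induction A rule: infinite_finite_induct) (simp_all add: alg_gen_0 alg_gen_add)

lemma alg_gen_prod: "(\<And>i. i \<in> A \<Longrightarrow> p i \<in> alg_gen y G) \<Longrightarrow> prod p A \<in> alg_gen y G"
  by (induction A rule: infinite_finite_induct) (simp_all add: alg_gen_1 alg_gen_mult)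

lemma alg_gen_power: "p \<in> alg_gen y G \<Longrightarrow> p ^ t \<in> alg_gen y G"
  by (induction t) (simp_all add: alg_gen_1 alg_gen_mult)

lemma alg_gen_gen:
  assumes "finite G" "i \<in> G" shows "y i \<in> alg_gen y G"
proof -
  have "(\<Prod>j\<in>G. y j ^ (if j = i then 1 else 0)) = (\<Prod>j\<in>G. if j = i then y j else 1)"
    by (intro prod.cong) auto
  also have "\<dots> = y i" using assms by simp
  finally have "y i = (\<Prod>j\<in>G. y j ^ (if j = i then 1 else 0))" by simp
  also have "\<dots> \<in> mpoly.span (monom_box y G 1)" by (intro mpoly.span_base monom_box_I) auto
  finally show ?thesis by (auto simp: alg_gen_def)
qed

text \<open>The lexicographically smallest exponent decides: modulo \<open>P i\<close> one cancels the lowest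
  power of \<open>x i\<close>, and modulo \<open>P (Suc i)\<close> only the terms divisible by no further \<open>x i\<close> survive.\<close>

lemma prime_chain_monomials_independent:
  fixes S :: "('k::field) mpoly set"
  assumes prime: "\<And>i. i \<le> d \<Longrightarrow> primeideal (P i) (subring_of S)"
    and sub: "\<And>i. i < d \<Longrightarrow> P i \<subseteq> P (Suc i)"
    and x: "\<And>i. i < d \<Longrightarrow> x i \<in> P (Suc i) - P i"
    and const: "\<And>c. const c \<in> S"
    and "i \<le> d" "finite A" "A \<noteq> {}" "inj_on (\<lambda>a. restrict a {i..<d}) A" "\<And>a. a \<in> A \<Longrightarrow> q a \<noteq> 0"
  shows "(\<Sum>a\<in>A. const (q a) * (\<Prod>j\<in>{i..<d}. x j ^ a j)) \<notin> P i"
  using assms(5-)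
proof (induction i arbitrary: A rule: inc_induct)
  case base
  note D = primeideal_subring_ofD[OF prime[OF order_refl]]
  from base obtain a where a: "a \<in> A" by blast
  \<comment> \<open>On the empty interval all restrictions agree, so injectivity leaves a single
    term, a nonzero constant.\<close>
  have "b = a" if "b \<in> A" for b
    using inj_onD[OF base(3) _ that a] by simp
  with a have A: "A = {a}" by blast
  show ?case
  proof
    assume "(\<Sum>a\<in>A. const (q a) * (\<Prod>j\<in>{d..<d}. x j ^ a j)) \<in> P d"
    then have "const (q a) \<in> P d" by (simp add: A)
    then have "const (1 / q a) * const (q a) \<in> P d" using D(6) const by blast
    then have "1 \<in> P d" using base(4)[of a] A by (simp flip: const_mult)
    then have "s \<in> P d" if "s \<in> S" for s using D(6)[OF that, of 1] by simp
    then show False using D(1,2) by auto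
  qed
next
  case (step i)
  have i: "i \<le> d" "Suc i \<le> d" "i < d" using step by auto
  note D = primeideal_subring_ofD[OF prime[OF i(1)]]
  note D' = primeideal_subring_ofD[OF prime[OF i(2)]]
  have xS: "x j \<in> S" if "j < d" for j
    using primeideal_subring_ofD(1)[OF prime[of "Suc j"]] x[OF that] that by auto
  have powS: "p ^ t \<in> S" if "p \<in> S" for p t
    by (induction t) (use that D(4,9) in auto)
  have prodS: "(\<Prod>j\<in>{l..<d}. x j ^ a j) \<in> S" for l a
  proof -
    have "(\<Prod>j\<in>J. x j ^ a j) \<in> S" if "finite J" "J \<subseteq> {..<d}" for J
      using that by induction (auto intro!: D(9) powS xS D(4))
    moreover have "{l..<d} \<subseteq> {..<d}" by auto
    ultimately show ?thesis by blast
  qed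
  have one: "1 \<notin> P i"
  proof
    assume "1 \<in> P i"
    then have "s \<in> P i" if "s \<in> S" for s using D(6)[OF that, of 1] by simp
    then show False using D(1,2) by auto
  qed
  define m where "m = Min ((\<lambda>a. a i) ` A)"
  have m: "m \<le> a i" if "a \<in> A" for a using that step.prems by (simp add: m_def)
  have pow: "x i ^ t \<notin> P i" for t
  proof (induction t)
    case (Suc t)
    then show ?case using D(7)[of "x i" "x i ^ t"] xS[OF i(3)] powS x[OF i(3)] by auto
  qed (use one in simp)
  define r where "r a = const (q a) * (\<Prod>j\<in>{Suc i..<d}. x j ^ a j)" for a
  have rS: "r a \<in> S" for a unfolding r_def by (intro D(9) const prodS)
  have split: "const (q a) * (\<Prod>j\<in>{i..<d}. x j ^ a j) = x i ^ m * (x i ^ (a i - m) * r a)"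
    if "a \<in> A" for a
    using m[OF that] i(3)
    by (simp add: prod.atLeast_Suc_lessThan r_def mult_ac flip: power_add)
  define t where "t = (\<Sum>a\<in>A. x i ^ (a i - m) * r a)"
  have sumS: "(\<Sum>a\<in>B. x i ^ (a i - m) * r a) \<in> S" for B
    by (induction B rule: infinite_finite_induct)
      (auto intro!: D(8,9) powS rS xS i(3) D(3)[THEN subsetD[OF D(1)]])
  \<comment> \<open>Terms that lose all of \<open>x i\<close> on division by \<open>x i ^ m\<close>.
    The others keep a factor \<open>x i\<close> and so vanish modulo
    \<open>P (Suc i)\<close>.\<close>
  define A0 where "A0 = {a \<in> A. a i = m}"
  show ?case
  proof
    assume "(\<Sum>a\<in>A. const (q a) * (\<Prod>j\<in>{i..<d}. x j ^ a j)) \<in> P i"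
    also have "(\<Sum>a\<in>A. const (q a) * (\<Prod>j\<in>{i..<d}. x j ^ a j)) = x i ^ m * t"
      by (simp add: t_def sum_distrib_left split)
    finally have "t \<in> P i" using D(7)[of "x i ^ m" t] pow powS xS i(3) sumS by (auto simp: t_def)
    then have tP: "t \<in> P (Suc i)" using sub i by blast
    have "(\<Sum>a\<in>B. x i ^ (a i - m) * r a) \<in> P (Suc i)" if "B \<subseteq> A - A0" for B
      using that
    proof (induction B rule: infinite_finite_induct)
      case (insert a B)
      then have "m < a i" using m[of a] by (auto simp: A0_def le_less)
      then have "x i ^ (a i - m) * r a = (x i ^ (a i - m - 1) * r a) * x i"
        using power_Suc[of "x i" "a i - m - 1"] by (simp add: Suc_diff_Suc mult_ac)
      also have "\<dots> \<in> P (Suc i)" using x i(3) xS powS rS by (intro D'(6) D(9)) auto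
      finally show ?case using insert D'(5) by auto
    qed (use D'(3) in auto)
    from this[of "A - A0"] have "const (-1) * (\<Sum>a\<in>A - A0. x i ^ (a i - m) * r a) \<in> P (Suc i)"
      using D'(6) const by blast
    from D'(5)[OF tP this] have "t - (\<Sum>a\<in>A - A0. x i ^ (a i - m) * r a) \<in> P (Suc i)"
      by (simp add: const_uminus)
    also have "t - (\<Sum>a\<in>A - A0. x i ^ (a i - m) * r a) = (\<Sum>a\<in>A0. x i ^ (a i - m) * r a)"
      unfolding t_def using step.prems by (subst sum.subset_diff[of A0 A]) (auto simp: A0_def)
    also have "\<dots> = (\<Sum>a\<in>A0. r a)" by (intro sum.cong) (auto simp: A0_def)
    finally have "(\<Sum>a\<in>A0. r a) \<in> P (Suc i)" .
    moreover have "(\<Sum>a\<in>A0. r a) \<notin> P (Suc i)"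
      unfolding r_def
    proof (rule step.IH)
      have "m \<in> (\<lambda>a. a i) ` A" unfolding m_def using step.prems by (intro Min_in) auto
      then show "A0 \<noteq> {}" by (auto simp: A0_def)
      show "inj_on (\<lambda>a. restrict a {Suc i..<d}) A0"
      proof (rule inj_onI)
        fix a b assume ab: "a \<in> A0" "b \<in> A0" "restrict a {Suc i..<d} = restrict b {Suc i..<d}"
        have "a j = b j" if "j \<in> {i..<d}" for j
        proof (cases "j = i")
          case False
          with that show ?thesis using fun_cong[OF ab(3), of j] by auto
        qed (use ab in \<open>auto simp: A0_def\<close>)
        then have eq: "restrict a {i..<d} = restrict b {i..<d}" by (auto simp: restrict_def)
        have "a \<in> A" "b \<in> A" using ab by (simp_all add: A0_def)
        from inj_onD[OF step.prems(3) eq this] show "a = b" .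
      qed
    qed (use step.prems in \<open>auto simp: A0_def\<close>)
    ultimately show False by contradiction
  qed
qed

text \<open>Witnesses of the first \<open>card G + 1\<close> strict inclusions would be
  algebraically independent, yet the \<open>N ^ (card G + 1)\<close> monomials in them with
  exponents below \<open>N\<close> lie in a span whose dimension grows only like
  \<open>N ^ card G\<close>.\<close>

lemma prime_chain_length_le:
  fixes S :: "('k::field) mpoly set"
  assumes G: "finite G" "S \<subseteq> alg_gen y G" and const: "\<And>c. const c \<in> S"
    and prime: "\<And>i. i \<le> d \<Longrightarrow> primeideal (P i) (subring_of S)"
    and sub: "\<And>i. i < d \<Longrightarrow> P i \<subset> P (Suc i)"
  shows "d \<le> card G"
proof (rule ccontr)
  assume "\<not> d \<le> card G"
  define r where "r = card G"
  \<comment> \<open>One step more than there are generators already gives the contradiction, so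
    longer chains are cut off here.\<close>
  define e where "e = Suc r"
  have ed: "e \<le> d" using \<open>\<not> d \<le> card G\<close> by (simp add: e_def r_def)
  have "\<exists>x. x \<in> P (Suc i) - P i" if "i < e" for i
    using sub[of i] that ed by (intro psubset_imp_ex_mem) auto
  then obtain x where x: "\<And>i. i < e \<Longrightarrow> x i \<in> P (Suc i) - P i" by metis
  have "\<exists>E. x i \<in> mpoly.span (monom_box y G E)" if "i < e" for i
    using x[OF that] primeideal_subring_ofD(1)[OF prime[of "Suc i"]] G(2) that ed
    by (auto simp: alg_gen_def)
  then obtain E' where E': "\<And>i. i < e \<Longrightarrow> x i \<in> mpoly.span (monom_box y G (E' i))" by metis
  define E where "E = (\<Sum>i<e. E' i)"
  have E: "x i \<in> mpoly.span (monom_box y G E)" if "i < e" for i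
    using that by (auto intro!: span_monom_box_mono[OF E'] member_le_sum simp: E_def)
  \<comment> \<open>Since \<open>e * (N * E) + 1 \<le> N * (e * E + 1)\<close>, the box
    \<open>B\<close> below has at most \<open>N ^ r * (e * E + 1) ^ r\<close> elements; this
    \<open>N\<close> exceeds the second factor.\<close>
  define N where "N = (e * E + 1) ^ r + 1"
  define A where "A = {0..<e} \<rightarrow>\<^sub>E {..<N}"
  define B where "B = monom_box y G (e * (N * E))"
  have finA: "finite A" and finB: "finite B" using G by (auto simp: A_def B_def finite_PiE finite_monom_box)
  have "card B \<le> (e * (N * E) + 1) ^ r" using card_monom_box[OF G(1)] by (simp add: B_def r_def)
  also have "\<dots> \<le> (N * (e * E + 1)) ^ r" by (intro power_mono) (auto simp: N_def algebra_simps)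
  also have "\<dots> < N ^ r * N"
  proof -
    have "(e * E + 1) ^ r < N" "0 < N ^ r" by (simp_all add: N_def)
    then show ?thesis unfolding power_mult_distrib by (rule mult_strict_left_mono)
  qed
  also have "\<dots> = card A" by (simp add: A_def card_PiE e_def)
  finally have less: "card B < card A" .
  define X where "X a = (\<Prod>i\<in>{0..<e}. x i ^ a i)" for a
  have "X a \<in> mpoly.span B" if "a \<in> A" for a
  proof -
    have "X a \<in> mpoly.span (monom_box y G (\<Sum>i\<in>{0..<e}. N * E))"
      unfolding X_def
    proof (rule span_monom_box_prod)
      fix i assume i: "i \<in> {0..<e}"
      then have "a i \<le> N" using that by (auto simp: A_def PiE_def Pi_def less_imp_le)
      then show "x i ^ a i \<in> mpoly.span (monom_box y G (N * E))"
        using i by (intro span_monom_box_mono[OF span_monom_box_power[OF E]] mult_right_mono) auto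
    qed simp
    then show ?thesis by (simp add: B_def)
  qed
  then have "\<forall>a\<in>A. \<exists>c. X a = (\<Sum>v\<in>B. const (c v) * v)"
    unfolding mpoly.span_finite[OF finB] by auto
  from bchoice[OF this] obtain c where c: "\<And>a. a \<in> A \<Longrightarrow> X a = (\<Sum>v\<in>B. const (c a v) * v)"
    by blast
  obtain u where u: "\<exists>a\<in>A. u a \<noteq> 0" "\<forall>v\<in>B. (\<Sum>a\<in>A. u a * c a v) = 0"
    using homogeneous_system_nontrivial_solution[OF finB finA less, of c] by blast
  have const_sum: "const (\<Sum>a\<in>T. w a) = (\<Sum>a\<in>T. const (w a))" for w :: "'t \<Rightarrow> 'k" and T
    by (induction T rule: infinite_finite_induct) (auto simp: const_add)
  have "(\<Sum>a\<in>A. const (u a) * X a) = (\<Sum>a\<in>A. \<Sum>v\<in>B. const (u a * c a v) * v)"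
    by (rule sum.cong[OF refl]) (simp only: c sum_distrib_left const_mult mult.assoc)
  also have "\<dots> = (\<Sum>v\<in>B. const (\<Sum>a\<in>A. u a * c a v) * v)"
    by (subst sum.swap) (simp only: const_sum sum_distrib_right)
  also have "\<dots> = 0" using u(2) by simp
  finally have zero: "(\<Sum>a\<in>A. const (u a) * X a) = 0" .
  \<comment> \<open>The independence lemma asks for nonzero coefficients, so the vanishing ones are
    dropped.\<close>
  define A' where "A' = {a \<in> A. u a \<noteq> 0}"
  have "(\<Sum>a\<in>A'. const (u a) * X a) = 0"
    unfolding zero[symmetric] A'_def using finA by (intro sum.mono_neutral_left) auto
  moreover have "(\<Sum>a\<in>A'. const (u a) * (\<Prod>j\<in>{0..<e}. x j ^ a j)) \<notin> P 0"
  proof (rule prime_chain_monomials_independent[of e P S])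
    show "inj_on (\<lambda>a. restrict a {0..<e}) A'"
      by (rule inj_onI) (auto simp: A'_def A_def PiE_restrict)
    show "P i \<subseteq> P (Suc i)" if "i < e" for i using sub[of i] that ed by auto
  qed (use prime x const ed u(1) finA in \<open>auto simp: A'_def\<close>)
  ultimately show False using primeideal_subring_ofD(3)[OF prime[of 0]] by (simp add: X_def)
qed

lemma krull_dim_le:
  fixes S :: "('k::field) mpoly set"
  assumes "finite G" "S \<subseteq> alg_gen y G" "\<And>c. const c \<in> S"
  shows "krull_dim S \<le> card G"
proof -
  let ?D = "{d. \<exists>P. (\<forall>i\<le>d. primeideal (P i) (subring_of S)) \<and> (\<forall>i<d. P i \<subset> P (Suc i))}"
  have *: "d \<le> card G" if "d \<in> ?D" for d
    using that prime_chain_length_le[OF assms] by auto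
  show ?thesis
  proof (cases "?D = {}")
    case False
    show ?thesis unfolding krull_dim_def by (rule cSup_least[OF False *])
  next
    \<comment> \<open>The supremum of the empty set of natural numbers is 0.\<close>
    case True
    show ?thesis unfolding krull_dim_def True by simp
  qed
qed

section \<open>Krull dimensions of polynomial rings and of proper retracts\<close>

lemma var_power: "var i ^ t = single (single i t) 1"
  by (induction t) (simp_all add: var_def mult_single flip: single_add)

lemma single_eq_prod_var:
  "single m c = const c * (\<Prod>i\<in>keys m. var i ^ lookup m i)"
proof -
  have "(\<Prod>i\<in>A. var i ^ lookup m i :: 'a mpoly) = single (\<Sum>i\<in>A. single i (lookup m i)) 1"
    if "finite A" for A
    using that by induction (simp_all add: var_power mult_single)
  then show ?thesis
    by (simp add: poly_mapping_sum_singles flip: single_eq_const_mult)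
qed

lemma ppoly_subset_alg_gen:
  assumes "finite Z"
  shows "ppoly Z \<subseteq> alg_gen var Z"
proof
  fix p assume p: "p \<in> ppoly Z"
  have "(\<Sum>m\<in>keys p. single m (lookup p m)) \<in> alg_gen var Z"
    unfolding single_eq_prod_var
    using p assms
    by (intro alg_gen_sum alg_gen_mult alg_gen_prod alg_gen_power alg_gen_const alg_gen_gen)
      (auto simp: ppoly_def)
  then show "p \<in> alg_gen var Z" by (simp add: poly_mapping_sum_singles)
qed

text \<open>A supremum of natural numbers dominates its members only if the set is bounded above, so
  this lower bound also rests on the length bound for prime chains.\<close>

lemma krull_dim_ppoly_ge:
  assumes "finite Z"
  shows "card Z \<le> krull_dim (ppoly Z :: ('k::field) mpoly set)"
  unfolding krull_dim_def
proof (rule cSup_upper)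
  show "card Z \<in> {d. \<exists>P. (\<forall>i\<le>d. primeideal (P i) (subring_of (ppoly Z :: 'k mpoly set)))
      \<and> (\<forall>i<d. P i \<subset> P (Suc i))}"
    using ppoly_prime_chain[OF assms] by simp
  show "bdd_above {d. \<exists>P. (\<forall>i\<le>d. primeideal (P i) (subring_of (ppoly Z :: 'k mpoly set)))
      \<and> (\<forall>i<d. P i \<subset> P (Suc i))}"
    by (rule bdd_aboveI[of _ "card Z"])
      (use prime_chain_length_le[OF assms ppoly_subset_alg_gen[OF assms] ppoly_const] in auto)
qed

text \<open>A retraction that is not the identity kills a linear form, so one of the images of the
  variables is redundant as a generator.\<close>

lemma krull_dim_proper_retract:
  fixes S :: "('k::field) mpoly set"
  assumes "graded_retract g n S" "S \<noteq> polyR n"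
    and lin: "\<And>m i. g m = g (single i 1) \<Longrightarrow> \<exists>j. m = single j 1"
  shows "krull_dim S \<le> n - 1"
proof -
  let ?R = "polyR n :: 'k mpoly set"
  obtain \<phi> where \<phi>: "graded_retraction g n S \<phi>" and S: "graded_subalgebra g n S"
    using assms(1) by (auto simp: graded_retract_def)
  have im: "\<phi> ` ?R = S" and add: "\<And>p q. p \<in> ?R \<Longrightarrow> q \<in> ?R \<Longrightarrow> \<phi> (p + q) = \<phi> p + \<phi> q"
    and mult: "\<And>p q. p \<in> ?R \<Longrightarrow> q \<in> ?R \<Longrightarrow> \<phi> (p * q) = \<phi> p * \<phi> q"
    and con: "\<And>c. \<phi> (const c) = const c"
    and hom: "\<And>p d. p \<in> ?R \<Longrightarrow> homog g d p \<Longrightarrow> homog g d (\<phi> p)"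
    and idem: "\<And>p. p \<in> S \<Longrightarrow> \<phi> p = p"
    using \<phi> by (auto simp: graded_retraction_def)
  have SR: "S \<subseteq> ?R" and constS: "\<And>c. const c \<in> S"
    using S by (auto simp: graded_subalgebra_def)
  note R = ppoly_add ppoly_mult ppoly_const ppoly_1 ppoly_0 ppoly_var ppoly_uminus
  have zero: "\<phi> 0 = 0" and one: "\<phi> 1 = 1" using con[of 0] con[of 1] by simp_all
  have prodR: "finite A \<Longrightarrow> (\<And>i. i \<in> A \<Longrightarrow> p i \<in> ?R) \<Longrightarrow> prod p A \<in> ?R \<and> \<phi> (prod p A) = (\<Prod>i\<in>A. \<phi> (p i))"
    for A :: "nat set" and p
    by (induction A rule: finite_induct) (auto simp: one mult polyR_eq_ppoly R)
  have powR: "p \<in> ?R \<Longrightarrow> p ^ t \<in> ?R \<and> \<phi> (p ^ t) = \<phi> p ^ t" for p t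
    by (induction t) (auto simp: one mult polyR_eq_ppoly R)
  have varR: "var i \<in> ?R" if "i < n" for i using that by (simp add: polyR_eq_ppoly R)
  have sumR: "(\<And>i. i \<in> A \<Longrightarrow> p i \<in> ?R) \<Longrightarrow> \<phi> (sum p A) = (\<Sum>i\<in>A. \<phi> (p i))"
    for A :: "'x set" and p
    by (induction A rule: infinite_finite_induct)
      (auto simp: zero add ppoly_sum polyR_eq_ppoly)
  have sing: "\<phi> (single m c) = const c * (\<Prod>i\<in>keys m. \<phi> (var i) ^ lookup m i)"
    if "keys m \<subseteq> {..<n}" for m c
  proof -
    have v: "var i ^ lookup m i \<in> ?R \<and> \<phi> (var i ^ lookup m i) = \<phi> (var i) ^ lookup m i"
      if "i \<in> keys m" for i
      using \<open>keys m \<subseteq> {..<n}\<close> that by (intro powR varR) auto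
    have "(\<Prod>i\<in>keys m. var i ^ lookup m i) \<in> ?R \<and>
        \<phi> (\<Prod>i\<in>keys m. var i ^ lookup m i) = (\<Prod>i\<in>keys m. \<phi> (var i ^ lookup m i))"
      using v by (intro prodR) auto
    moreover have "const c \<in> ?R" by (simp add: polyR_eq_ppoly R)
    ultimately show ?thesis unfolding single_eq_prod_var using v by (simp add: mult con)
  qed
  \<comment> \<open>As an algebra map, \<open>\<phi>\<close> is determined by the images of the
    variables.\<close>
  have expand: "\<phi> p = (\<Sum>m\<in>keys p. const (lookup p m) * (\<Prod>i\<in>keys m. \<phi> (var i) ^ lookup m i))"
    if "p \<in> ?R" for p
  proof -
    have k: "keys m \<subseteq> {..<n}" if "m \<in> keys p" for m using \<open>p \<in> ?R\<close> that by (auto simp: polyR_def)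
    have "\<phi> p = \<phi> (\<Sum>m\<in>keys p. single m (lookup p m))" by (simp add: poly_mapping_sum_singles)
    also have "\<dots> = (\<Sum>m\<in>keys p. \<phi> (single m (lookup p m)))"
      using k by (intro sumR) (auto simp: polyR_def)
    also have "\<dots> = (\<Sum>m\<in>keys p. const (lookup p m) * (\<Prod>i\<in>keys m. \<phi> (var i) ^ lookup m i))"
      using k by (intro sum.cong refl sing)
    finally show ?thesis .
  qed
  have "\<exists>j<n. \<phi> (var j) \<noteq> var j"
  proof (rule ccontr)
    assume "\<not> (\<exists>j<n. \<phi> (var j) \<noteq> var j)"
    then have v: "\<phi> (var j) = var j" if "j < n" for j using that by auto
    have "\<phi> p = p" if "p \<in> ?R" for p
    proof -
      have k: "keys m \<subseteq> {..<n}" if "m \<in> keys p" for m using \<open>p \<in> ?R\<close> that by (auto simp: polyR_def)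
      have "\<phi> p = (\<Sum>m\<in>keys p. const (lookup p m) * (\<Prod>i\<in>keys m. var i ^ lookup m i))"
        unfolding expand[OF that]
      proof (rule sum.cong[OF refl])
        fix m assume "m \<in> keys p"
        then have "\<phi> (var i) = var i" if "i \<in> keys m" for i using k v that by auto
        then show "const (lookup p m) * (\<Prod>i\<in>keys m. \<phi> (var i) ^ lookup m i)
            = const (lookup p m) * (\<Prod>i\<in>keys m. var i ^ lookup m i)"
          by (simp cong: prod.cong)
      qed
      also have "\<dots> = p" by (simp add: poly_mapping_sum_singles flip: single_eq_prod_var)
      finally show ?thesis .
    qed
    then have "S = ?R" using im by auto
    with assms(2) show False by contradiction
  qed
  then obtain j0 where j0: "j0 < n" "\<phi> (var j0) \<noteq> var j0" by blast
  \<comment> \<open>\<open>\<phi>\<close> fixes its own value \<open>\<phi> (var j0)\<close>, so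
    this difference is a nonzero element of the kernel.\<close>
  define q where "q = var j0 - \<phi> (var j0)"
  have \<phi>S: "\<phi> (var j0) \<in> S" using im varR j0 by auto
  have qR: "q \<in> ?R"
    using ppoly_add[OF varR[OF j0(1), unfolded polyR_eq_ppoly] ppoly_uminus[of "\<phi> (var j0)"]] \<phi>S SR
    by (auto simp: q_def polyR_eq_ppoly)
  have "\<phi> (var j0) = \<phi> (q + \<phi> (var j0))" by (simp add: q_def)
  also have "\<dots> = \<phi> q + \<phi> (var j0)" using add[OF qR, of "\<phi> (var j0)"] \<phi>S SR idem by auto
  finally have q0: "\<phi> q = 0" by simp
  have "homog g (g (single j0 1)) (var j0 :: 'k mpoly)" by (simp add: homog_def homog_sh_def var_def)
  then have h: "homog g (g (single j0 1)) (\<phi> (var j0))" using hom varR j0 by blast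
  \<comment> \<open>Preservation of degrees together with \<open>lin\<close> makes \<open>q\<close>
    a linear form.\<close>
  have qkeys: "\<exists>i<n. m = single i 1" if "m \<in> keys q" for m
  proof -
    have "m = single j0 1 \<or> m \<in> keys (\<phi> (var j0))"
      using that unfolding in_keys_iff by (auto simp: q_def lookup_minus var_def lookup_single when_def)
    then obtain i where i: "m = single i 1"
      using h lin[of m j0] by (auto simp: homog_def homog_sh_def)
    have "keys m \<subseteq> {..<n}" using qR that by (auto simp: polyR_def)
    then show ?thesis using i by auto
  qed
  have "q \<noteq> 0" using j0 by (simp add: q_def)
  then obtain m where "m \<in> keys q" using poly_mapping_eqI[of q 0] by (auto simp: in_keys_iff)
  \<comment> \<open>Any variable occurring in \<open>q\<close> will do: by
    \<open>\<phi> q = 0\<close> its image is a linear combination of the images of the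
    others.\<close>
  with qkeys obtain j where j: "j < n" "single j 1 \<in> keys q" by blast
  define c where "c i = lookup q (single i 1)" for i
  have cj: "c j \<noteq> 0" using j by (simp add: c_def in_keys_iff)
  have "q = (\<Sum>i<n. const (c i) * var i)"
  proof (rule poly_mapping_eqI)
    fix m
    have "lookup (\<Sum>i<n. const (c i) * var i) m = (\<Sum>i<n. if single i 1 = m then c i else 0)"
      by (simp add: lookup_sum var_def lookup_single when_def if_distrib cong: if_cong)
    also have "\<dots> = lookup q m"
    proof (cases "m \<in> keys q")
      case True
      then obtain l where l: "l < n" "m = single l 1" using qkeys by blast
      have "single i 1 = m \<longleftrightarrow> i = l" for i
        unfolding l(2) by (metis keys_single one_neq_zero singleton_inject)
      then show ?thesis using l by (simp add: c_def)
    next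
      case False
      then have "(if single i 1 = m then c i else 0) = 0" for i by (auto simp: c_def in_keys_iff)
      then show ?thesis using False by (simp add: in_keys_iff)
    qed
    finally show "lookup q m = lookup (\<Sum>i<n. const (c i) * var i) m" by simp
  qed
  then have "\<phi> q = \<phi> (\<Sum>i<n. const (c i) * var i)" by simp
  also have "\<dots> = (\<Sum>i<n. \<phi> (const (c i) * var i))"
    by (rule sumR) (auto simp: polyR_eq_ppoly R)
  also have "\<dots> = (\<Sum>i<n. const (c i) * \<phi> (var i))"
    using mult varR by (intro sum.cong refl) (simp add: con polyR_eq_ppoly R)
  finally have "\<phi> q = (\<Sum>i<n. const (c i) * \<phi> (var i))" .
  then have "0 = const (c j) * \<phi> (var j) + (\<Sum>i\<in>{..<n} - {j}. const (c i) * \<phi> (var i))"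
    using q0 j by (simp add: sum.remove[of "{..<n}" j])
  then have "const (c j) * \<phi> (var j) = - (\<Sum>i\<in>{..<n} - {j}. const (c i) * \<phi> (var i))"
    by (simp only: eq_neg_iff_add_eq_0)
  then have "const (1 / c j) * (const (c j) * \<phi> (var j))
      = const (- 1 / c j) * (\<Sum>i\<in>{..<n} - {j}. const (c i) * \<phi> (var i))"
    by (simp only: minus_divide_left[symmetric] const_uminus mult_minus_left mult_minus_right)
  moreover have "const (1 / c j) * (const (c j) * \<phi> (var j)) = \<phi> (var j)"
    using cj by (simp flip: mult.assoc const_mult)
  ultimately have rel: "\<phi> (var j) = const (- 1 / c j) * (\<Sum>i\<in>{..<n} - {j}. const (c i) * \<phi> (var i))"
    by simp
  let ?G = "{..<n} - {j}"
  have gen: "\<phi> (var i) \<in> alg_gen (\<lambda>i. \<phi> (var i)) ?G" if "i \<in> ?G" for i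
    using alg_gen_gen[of ?G i "\<lambda>i. \<phi> (var i)"] that by simp
  have "\<phi> (var j) \<in> alg_gen (\<lambda>i. \<phi> (var i)) ?G"
    by (subst rel) (intro alg_gen_mult alg_gen_sum alg_gen_const gen)
  with gen have gen': "\<phi> (var i) \<in> alg_gen (\<lambda>i. \<phi> (var i)) ?G" if "i < n" for i
    using that by (cases "i = j") auto
  have "S \<subseteq> alg_gen (\<lambda>i. \<phi> (var i)) ?G"
  proof
    fix s assume "s \<in> S"
    then obtain p where p: "p \<in> ?R" "s = \<phi> p" using im by auto
    show "s \<in> alg_gen (\<lambda>i. \<phi> (var i)) ?G"
      unfolding p(2) expand[OF p(1)]
      by (intro alg_gen_sum alg_gen_mult alg_gen_prod alg_gen_power alg_gen_const gen')
        (use p(1) in \<open>auto simp: polyR_def\<close>)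
  qed
  from krull_dim_le[OF _ this constS] show ?thesis using j(1) by simp
qed

section \<open>A monomial basis of the syzygy module\<close>

lemma single_plus_minus: "i \<in> keys u \<Longrightarrow> single i 1 + (u - single i 1) = u" for u :: "nat \<Rightarrow>\<^sub>0 nat"
  by (rule poly_mapping_eqI) (auto simp: lookup_add lookup_minus lookup_single when_def in_keys_iff)

lemma lookup_const_var_mult:
  "lookup (const c * var i * p) u = (if i \<in> keys u then c * lookup p (u - single i 1) else 0)"
proof (cases "i \<in> keys u")
  case True
  then show ?thesis
    using lookup_single_mult[of "single i 1" c p "u - single i 1"] single_plus_minus[OF True]
    by (simp add: const_var_mult)
next
  case False
  then have "u \<noteq> single i 1 + v" for v by (auto simp: keys_plus_nat)
  then show ?thesis using False by (simp add: const_var_mult lookup_single_mult_eq_0)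
qed

section \<open>The Koszul differential and its image\<close>

definition ksign :: "nat set \<Rightarrow> nat \<Rightarrow> 'k::field" where
  "ksign J i = (-1) ^ card {j\<in>J. j < i}"

lemma koszul_d_ksign:
  "koszul_d n y J = (\<Sum>i\<in>{..<n} - J. const (ksign J i) * var i * y (insert i J))"
  by (simp add: koszul_d_def ksign_def)

lemma lookup_koszul_d:
  "lookup (koszul_d n y J) u = (\<Sum>i\<in>{..<n} - J. if i \<in> keys u
     then ksign J i * lookup (y (insert i J)) (u - single i 1) else 0)"
  by (simp only: koszul_d_ksign lookup_sum lookup_const_var_mult)

lemma koszul_d_add: "koszul_d n (\<lambda>I. a I + b I) J = koszul_d n a J + koszul_d n b J"
  by (simp add: koszul_d_def distrib_left sum.distrib)

lemma koszul_d_scale: "koszul_d n (\<lambda>I. const c * a I) J = const c * koszul_d n a J"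
  by (simp only: koszul_d_def sum_distrib_left mult_ac)

lemma ksign_insert:
  assumes "i \<notin> J"
  shows "ksign (insert i J) l = (if i < l then - ksign J l else ksign J l)"
proof -
  have "{j \<in> insert i J. j < l} = (if i < l then insert i {j\<in>J. j < l} else {j\<in>J. j < l})" by auto
  moreover have "finite {j\<in>J. j < l}" by simp
  ultimately show ?thesis using assms by (simp add: ksign_def)
qed

text \<open>The row of a new element cancels against its column. Doubling the sum and halving it
  again would fail in characteristic 2.\<close>

lemma sum_antisym_off_diag:
  fixes t :: "'a \<Rightarrow> 'a \<Rightarrow> 'b::ab_group_add"
  assumes "finite A" "\<And>i l. i \<in> A \<Longrightarrow> l \<in> A \<Longrightarrow> i \<noteq> l \<Longrightarrow> t i l + t l i = 0"
  shows "(\<Sum>i\<in>A. \<Sum>l\<in>A - {i}. t i l) = 0"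
  using assms
proof (induction A)
  case (insert a A)
  have "(\<Sum>l\<in>insert a A - {i}. t i l) = t i a + (\<Sum>l\<in>A - {i}. t i l)" if "i \<in> A" for i
    using that insert.hyps by (subst insert_Diff_if) auto
  then have "(\<Sum>i\<in>insert a A. \<Sum>l\<in>insert a A - {i}. t i l)
      = (\<Sum>l\<in>A. t a l) + (\<Sum>i\<in>A. t i a + (\<Sum>l\<in>A - {i}. t i l))"
    using insert.hyps by simp
  also have "\<dots> = (\<Sum>i\<in>A. t a i + t i a)" using insert by (simp add: sum.distrib)
  also have "\<dots> = 0" using insert by (intro sum.neutral) auto
  finally show ?case .
qed simp

text \<open>Inserting \<open>i\<close> and \<open>l\<close> in the two possible orders gives the
  same term with opposite signs.\<close>

lemma koszul_d_koszul_d: "koszul_d n (koszul_d n y) J = 0"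
proof -
  define t where "t i l = const (ksign J i) * var i
    * (const (ksign (insert i J) l) * var l * y (insert l (insert i J)))" for i l
  have "koszul_d n (koszul_d n y) J = (\<Sum>i\<in>{..<n} - J. \<Sum>l\<in>{..<n} - insert i J. t i l)"
    by (simp only: koszul_d_ksign sum_distrib_left t_def)
  also have "\<dots> = (\<Sum>i\<in>{..<n} - J. \<Sum>l\<in>({..<n} - J) - {i}. t i l)"
    by (rule sum.cong[OF refl], rule sum.cong) auto
  also have "\<dots> = 0"
  proof (rule sum_antisym_off_diag)
    fix i l assume il: "i \<in> {..<n} - J" "l \<in> {..<n} - J" "i \<noteq> l"
    have t: "t i l = const (ksign J i * ksign (insert i J) l) * (var i * var l * y (insert l (insert i J)))"
      for i l by (simp only: t_def const_mult mult_ac)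
    have "ksign J i * ksign (insert i J) l = - (ksign J l * ksign (insert l J) i :: 'a)"
      using il by (auto simp: ksign_insert not_less_iff_gr_or_eq)
    then show "t i l + t l i = 0"
      by (simp add: t const_uminus insert_commute mult.commute)
  qed simp
  finally show ?thesis .
qed

definition ksubs :: "nat \<Rightarrow> nat \<Rightarrow> nat set set" where
  "ksubs n k = {I. I \<subseteq> {..<n} \<and> card I = k}"

lemma finite_ksubs: "finite (ksubs n k)"
  by (rule finite_subset[of _ "Pow {..<n}"]) (auto simp: ksubs_def)

lemma Mmod_vanish:
  assumes "y \<in> Mmod n k" "1 \<le> k" "J \<notin> ksubs n (k - 1)"
  shows "y J = 0"
proof -
  obtain z where z: "z \<in> wedge n k" "y = koszul_d n z" using assms by (auto simp: Mmod_def)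
  have "z (insert i J) = 0" if "i \<in> {..<n} - J" for i
  proof (rule ccontr)
    assume "z (insert i J) \<noteq> 0"
    then have ins: "insert i J \<subseteq> {..<n}" "card (insert i J) = k" using z(1) unfolding wedge_def by blast+
    then have "finite J" by (auto intro: finite_subset)
    with ins that assms show False by (auto simp: ksubs_def)
  qed
  then show ?thesis by (simp add: z koszul_d_def)
qed

lemma Mmod_polyR:
  assumes "y \<in> Mmod n k"
  shows "y J \<in> polyR n"
proof -
  obtain z where z: "z \<in> wedge n k" "y = koszul_d n z" using assms by (auto simp: Mmod_def)
  then show ?thesis unfolding polyR_eq_ppoly koszul_d_def
    by (auto intro!: ppoly_sum ppoly_mult ppoly_const ppoly_var simp: wedge_def polyR_eq_ppoly)
qed

lemma Mmod_add:
  assumes "a \<in> Mmod n k" "b \<in> Mmod n k"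
  shows "(\<lambda>I. a I + b I) \<in> Mmod n k"
proof -
  obtain w z where "w \<in> wedge n k" "z \<in> wedge n k" "a = koszul_d n w" "b = koszul_d n z"
    using assms by (auto simp: Mmod_def)
  moreover from this have "(\<lambda>I. w I + z I) \<in> wedge n k"
    by (auto simp: wedge_def polyR_eq_ppoly ppoly_add)
  ultimately show ?thesis unfolding Mmod_def
    by (intro image_eqI[of _ _ "\<lambda>I. w I + z I"]) (auto simp: koszul_d_add)
qed

lemma Mmod_scale:
  assumes "a \<in> Mmod n k"
  shows "(\<lambda>I. const c * a I) \<in> Mmod n k"
proof -
  obtain w where "w \<in> wedge n k" "a = koszul_d n w" using assms by (auto simp: Mmod_def)
  moreover from this have "(\<lambda>I. const c * w I) \<in> wedge n k"
    by (auto simp: wedge_def polyR_eq_ppoly ppoly_const ppoly_mult)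
  ultimately show ?thesis unfolding Mmod_def
    by (intro image_eqI[of _ _ "\<lambda>I. const c * w I"]) (auto simp: koszul_d_scale)
qed

lemma Mmod_0: "(\<lambda>I. 0) \<in> Mmod n k"
proof -
  have "koszul_d n (\<lambda>I. 0) \<in> Mmod n k"
    unfolding Mmod_def by (rule imageI) (simp add: wedge_def polyR_eq_ppoly ppoly_0)
  then show ?thesis by (simp add: koszul_d_def)
qed

lemma Mmod_lincomb:
  assumes "\<And>x. x \<in> A \<Longrightarrow> f x \<in> Mmod n k"
  shows "(\<lambda>I. \<Sum>x\<in>A. const (u x) * f x I) \<in> Mmod n k"
  using assms
  by (induction A rule: infinite_finite_induct) (auto simp: Mmod_0 intro!: Mmod_add Mmod_scale)

lemma Mmod_koszul_d: "y \<in> Mmod n k \<Longrightarrow> koszul_d n y J = 0"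
  by (auto simp: Mmod_def koszul_d_koszul_d)

text \<open>This is for the case \<open>k = 1\<close>, \<open>J = {}\<close>: the Koszul complex has
  homology in degree 0, so the cycle condition does not control the constant term.\<close>

lemma Mmod_lookup_0: "y \<in> Mmod n k \<Longrightarrow> lookup (y J) 0 = 0"
  by (auto simp: Mmod_def lookup_koszul_d)

text \<open>Among the basis elements, only the one indexed by \<open>(I, m)\<close> contributes to the monomial
  \<open>X\<^bsub>min I\<^esub> X\<^sup>m\<close> of the coefficient of \<open>e\<^bsub>I - {min I}\<^esub>\<close>, which is therefore the coordinate.\<close>

definition kbasis :: "nat \<Rightarrow> nat \<Rightarrow> (nat set \<times> (nat \<Rightarrow>\<^sub>0 nat)) set" where
  "kbasis n k = {(I, m). I \<in> ksubs n k \<and> keys m \<subseteq> {Min I..<n}}"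

definition kelem :: "nat \<Rightarrow> nat set \<times> (nat \<Rightarrow>\<^sub>0 nat) \<Rightarrow> nat set \<Rightarrow> ('k::field) mpoly" where
  "kelem n x = koszul_d n (\<lambda>J. if J = fst x then single (snd x) 1 else 0)"

definition kcoord :: "(nat set \<Rightarrow> ('k::field) mpoly) \<Rightarrow> nat set \<times> (nat \<Rightarrow>\<^sub>0 nat) \<Rightarrow> 'k" where
  "kcoord y x = lookup (y (fst x - {Min (fst x)})) (single (Min (fst x)) 1 + snd x)"

lemma kbasisD:
  assumes "(I, m) \<in> kbasis n k" "1 \<le> k"
  shows "I \<subseteq> {..<n}" "card I = k" "finite I" "Min I \<in> I" "keys m \<subseteq> {Min I..<n}" "keys m \<subseteq> {..<n}"
proof -
  show 1: "I \<subseteq> {..<n}" "card I = k" "keys m \<subseteq> {Min I..<n}" using assms by (auto simp: kbasis_def ksubs_def)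
  then show "finite I" by (auto intro: finite_subset)
  then show "Min I \<in> I" using 1 assms by (intro Min_in) auto
  show "keys m \<subseteq> {..<n}" using 1 by auto
qed

lemma kelem_in_Mmod:
  assumes "(I, m) \<in> kbasis n k" "1 \<le> k"
  shows "kelem n (I, m) \<in> Mmod n k"
  using kbasisD[OF assms] unfolding Mmod_def kelem_def
  by (intro imageI) (auto simp: wedge_def polyR_eq_ppoly ppoly_single ppoly_0)

lemma kelem_at:
  assumes "i \<in> I" "I \<subseteq> {..<n}"
  shows "kelem n (I, m) (I - {i}) = single (single i 1 + m) (ksign (I - {i}) i)"
proof -
  have "insert i' (I - {i}) = I \<longleftrightarrow> i' = i" if "i' \<notin> I - {i}" for i' using that assms by auto
  then have "kelem n (I, m) (I - {i}) = (\<Sum>i'\<in>{..<n} - (I - {i}). if i' = i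
      then const (ksign (I - {i}) i') * var i' * single m 1 else 0)"
    unfolding kelem_def koszul_d_ksign by (intro sum.cong) auto
  also have "\<dots> = const (ksign (I - {i}) i) * var i * single m 1"
    using assms by (subst sum.delta) auto
  also have "\<dots> = single (single i 1 + m) (ksign (I - {i}) i)"
    by (simp add: const_var_mult mult_single)
  finally show ?thesis .
qed

lemma kelem_eq_0:
  assumes "\<And>i. i \<in> I \<Longrightarrow> J \<noteq> I - {i}"
  shows "kelem n (I, m) J = 0"
proof -
  have "insert i J \<noteq> I" if "i \<notin> J" for i
    using assms[of i] that by auto
  then show ?thesis unfolding kelem_def koszul_d_ksign by (intro sum.neutral) auto
qed

text \<open>A nonzero coordinate requires \<open>I' - {Min I'} = I - {i}\<close> and equality of the
  monomials X_i X^m and X_(Min I') X^m'. Comparing the least variables and the least indices forces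
  \<open>i = Min I = Min I'\<close>, and then both pairs agree.\<close>

lemma kcoord_kelem:
  assumes "x \<in> kbasis n k" "x' \<in> kbasis n k" "1 \<le> k"
  shows "kcoord (kelem n x) x' = (if x = x' then 1 else (0 :: 'k::field))"
proof -
  obtain I m I' m' where x: "x = (I, m)" "x' = (I', m')" by (cases x, cases x')
  note B = kbasisD[OF assms(1)[unfolded x] assms(3)]
  note B' = kbasisD[OF assms(2)[unfolded x] assms(3)]
  let ?v = "Min I" and ?v' = "Min I'"
  have Iv: "?v \<le> j" if "j \<in> I" for j using B that by auto
  have Iv': "?v' \<le> j" if "j \<in> I'" for j using B' that by auto
  show ?thesis
  proof (cases "x = x'")
    case True
    have "{j \<in> I - {?v}. j < ?v} = {}" using Iv by (auto simp: not_less)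
    then have "ksign (I - {?v}) ?v = (1::'k)" by (simp only: ksign_def card.empty power_0)
    then show ?thesis using True B by (simp add: x kcoord_def kelem_at)
  next
    case False
    have "kcoord (kelem n x) x' = (0::'k)"
    proof (rule ccontr)
      assume nz: "kcoord (kelem n x) x' \<noteq> (0::'k)"
      then have "kelem n (I, m) (I' - {?v'}) \<noteq> (0 :: 'k mpoly)" by (auto simp: kcoord_def x)
      then obtain i where i: "i \<in> I" "I' - {?v'} = I - {i}" using kelem_eq_0 by blast
      with nz B have eq: "single i 1 + m = single ?v' 1 + m'"
        by (auto simp: kcoord_def x kelem_at lookup_single when_def split: if_splits)
      then have keys: "insert i (keys m) = insert ?v' (keys m')"
        by (metis (no_types) keys_plus_nat keys_single insert_is_Un one_neq_zero)
      have le: "?v \<le> ?v'" using keys B Iv[OF i(1)] by auto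
      have "i = ?v"
      proof (rule ccontr)
        assume "i \<noteq> ?v"
        then have "?v \<in> I' - {?v'}" using i B by auto
        then show False using Iv'[of ?v] le by auto
      qed
      moreover have "?v' \<le> i" using equalityD1[OF keys] B'(5) by auto
      ultimately have "i = ?v'" using le by auto
      then have "m = m'" "I = I'" using eq i B' by auto
      then show False using False x by simp
    qed
    then show ?thesis using False by simp
  qed
qed

lemma kcoord_add: "kcoord (\<lambda>I. a I + b I) x = kcoord a x + kcoord b x"
  by (simp add: kcoord_def lookup_add)

lemma kcoord_lincomb: "kcoord (\<lambda>I. \<Sum>z\<in>A. const (u z) * f z I) x = (\<Sum>z\<in>A. u z * kcoord (f z) x)"
  by (simp add: kcoord_def lookup_sum)

text \<open>Coordinates are the coefficients whose monomial contains a variable below the index set.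
  The cycle condition expresses every other coefficient through coefficients of that kind.\<close>

lemma Mmod_eq_0:
  assumes y: "y \<in> Mmod n k" and k: "1 \<le> k" and co: "\<And>x. x \<in> kbasis n k \<Longrightarrow> kcoord y x = 0"
  shows "y J = 0"
proof -
  \<comment> \<open>If \<open>v\<close> is the least variable of \<open>u\<close> and lies below
    \<open>J\<close>, the coefficient is itself the coordinate of
    \<open>(insert v J, u - single v 1)\<close>.\<close>
  have low: "lookup (y J) u = 0" if "v \<in> keys u" "\<And>i. i \<in> keys u \<Longrightarrow> v \<le> i" "\<And>j. j \<in> J \<Longrightarrow> v < j" for u v J
  proof (cases "J \<in> ksubs n (k - 1) \<and> keys u \<subseteq> {..<n}")
    case True
    let ?I = "insert v J"
    have fin: "finite J" using True by (auto simp: ksubs_def intro: finite_subset)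
    then have I: "Min ?I = v" "v \<notin> J" using that by (auto intro!: Min_eqI simp: less_imp_le)
    have u: "single v 1 + (u - single v 1) = u" using that by (intro single_plus_minus)
    then have "keys (u - single v 1) \<subseteq> keys u" by (metis Un_upper2 keys_plus_nat)
    then have "(?I, u - single v 1) \<in> kbasis n k"
      using True k I fin that by (auto simp: kbasis_def ksubs_def subset_iff)
    from co[OF this] show ?thesis using I u by (simp add: kcoord_def)
  next
    case False
    then show ?thesis
      using Mmod_vanish[OF y k, of J] Mmod_polyR[OF y, of J]
      by (cases "J \<in> ksubs n (k - 1)") (auto simp: polyR_def in_keys_iff)
  qed
  have "lookup (y J) u = 0" for u
  proof (cases "J \<in> ksubs n (k - 1) \<and> u \<noteq> 0 \<or> J \<in> ksubs n (k - 1) \<and> J \<noteq> {}")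
    case False
    then show ?thesis using Mmod_vanish[OF y k, of J] Mmod_lookup_0[OF y, of J] by auto
  next
    case True
    have fin: "finite J" and sub: "J \<subseteq> {..<n}" using True by (auto simp: ksubs_def intro: finite_subset)
    show ?thesis
    proof (cases "\<exists>v\<in>keys u. \<forall>j\<in>J. v < j")
      case ex: True
      then have "keys u \<noteq> {}" by auto
      then have "Min (keys u) \<in> keys u" "\<And>i. i \<in> keys u \<Longrightarrow> Min (keys u) \<le> i" by auto
      moreover have "Min (keys u) < j" if "j \<in> J" for j
        using ex that by (meson Min_le finite_keys order_le_less_trans)
      ultimately show ?thesis by (rule low)
    next
      case notex: False
      have "J \<noteq> {}"
      proof
        assume "J = {}"
        with notex have "keys u = {}" by auto
        then have "u = 0" by (auto intro!: poly_mapping_eqI simp: in_keys_iff)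
        with True \<open>J = {}\<close> show False by auto
      qed
      define v where "v = Min J"
      have v: "v \<in> J" "\<And>j. j \<in> J \<Longrightarrow> v \<le> j" using fin \<open>J \<noteq> {}\<close> by (auto simp: v_def)
      have vu: "v \<le> i" if "i \<in> keys u" for i
        using notex that v by (meson le_trans not_le_imp_less)
      \<comment> \<open>The cycle condition is read at \<open>J - {v}\<close> and the monomial X_v
        X^u. A summand with \<open>i \<noteq> v\<close> is either absent or its monomial still
        contains X_v while its index set lies above \<open>v\<close>, so \<open>low\<close>
        applies.\<close>
      let ?u = "single v 1 + u" and ?J = "J - {v}"
      have ku: "keys ?u = insert v (keys u)" by (simp add: keys_plus_nat)
      define s where "s i = (if i \<in> keys ?u
          then ksign ?J i * lookup (y (insert i ?J)) (?u - single i 1) else 0)" for i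
      have "0 = (\<Sum>i\<in>{..<n} - ?J. s i)"
        using arg_cong[OF Mmod_koszul_d[OF y, of ?J], of "\<lambda>p. lookup p ?u"]
        by (simp only: lookup_koszul_d s_def lookup_zero)
      also have "\<dots> = s v + (\<Sum>i\<in>({..<n} - ?J) - {v}. s i)"
        using v sub by (intro sum.remove) auto
      also have "(\<Sum>i\<in>({..<n} - ?J) - {v}. s i) = 0"
      proof (rule sum.neutral, rule ballI)
        fix i assume i: "i \<in> ({..<n} - ?J) - {v}"
        show "s i = 0"
        proof (cases "i \<in> keys ?u")
          case True
          then have iu: "i \<in> keys u" "v < i" using i ku vu[of i] by auto
          have "lookup (y (insert i ?J)) (?u - single i 1) = 0"
          proof (rule low)
            have e: "single i 1 + (?u - single i 1) = ?u" by (rule single_plus_minus[OF True])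
            have "v \<in> keys (single i 1 + (?u - single i 1))" unfolding e ku by simp
            then show "v \<in> keys (?u - single i 1)" using iu by (auto simp: keys_plus_nat)
            fix l assume "l \<in> keys (?u - single i 1)"
            then have "l \<in> keys (single i 1 + (?u - single i 1))" by (simp add: keys_plus_nat)
            then show "v \<le> l" unfolding e using ku vu by auto
          next
            show "v < j" if "j \<in> insert i ?J" for j using that iu v(2)[of j] by auto
          qed
          then show ?thesis by (simp add: s_def)
        qed (simp add: s_def)
      qed
      finally have "s v = 0" by simp
      moreover have "v \<in> keys ?u" unfolding ku by simp
      then have "s v = ksign ?J v * lookup (y J) u"
        using v by (simp add: s_def insert_absorb)
      ultimately show ?thesis by (simp add: ksign_def)
    qed
  qed
  then show ?thesis by (intro poly_mapping_eqI) simp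
qed

lemma Mmod_eqI:
  assumes y: "y \<in> Mmod n k" "z \<in> Mmod n k" and k: "1 \<le> k"
    and co: "\<And>x. x \<in> kbasis n k \<Longrightarrow> kcoord y x = kcoord z x"
  shows "y = z"
proof
  fix J
  have "(\<lambda>I. y I + const (-1) * z I) \<in> Mmod n k"
    using y by (intro Mmod_add Mmod_scale)
  moreover have "kcoord (\<lambda>I. y I + const (-1) * z I) x = 0" if "x \<in> kbasis n k" for x
    using co[OF that] by (simp add: kcoord_def lookup_add lookup_minus const_uminus)
  ultimately have "y J + const (-1) * z J = 0" using Mmod_eq_0[OF _ k, of _ n J] by blast
  then show "y J = z J" by (simp add: const_uminus)
qed

lemma finite_kcoord_support:
  fixes y :: "nat set \<Rightarrow> ('k::field) mpoly"
  shows "finite {x \<in> kbasis n k. kcoord y x \<noteq> 0}"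
proof (rule finite_subset)
  let ?S = "Sigma (ksubs n k) (\<lambda>I. keys (y (I - {Min I})))"
  show "finite ((\<lambda>(I, u). (I, u - single (Min I) 1)) ` ?S)" by (auto simp: finite_ksubs)
  show "{x \<in> kbasis n k. kcoord y x \<noteq> 0} \<subseteq> (\<lambda>(I, u). (I, u - single (Min I) 1)) ` ?S"
  proof
    fix x assume "x \<in> {x \<in> kbasis n k. kcoord y x \<noteq> 0}"
    then obtain I m where "x = (I, m)" "I \<in> ksubs n k" "single (Min I) 1 + m \<in> keys (y (I - {Min I}))"
      by (cases x) (auto simp: kbasis_def kcoord_def in_keys_iff)
    then show "x \<in> (\<lambda>(I, u). (I, u - single (Min I) 1)) ` ?S"
      by (intro image_eqI[of _ _ "(I, single (Min I) 1 + m)"]) auto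
  qed
qed

lemma kcoord_kelem_lincomb:
  assumes "finite A" "A \<subseteq> kbasis n k" "x \<in> kbasis n k" "1 \<le> k"
  shows "kcoord (\<lambda>J. \<Sum>z\<in>A. const (u z) * kelem n z J) x = (if x \<in> A then u x else 0)"
proof -
  have "kcoord (\<lambda>J. \<Sum>z\<in>A. const (u z) * kelem n z J) x = (\<Sum>z\<in>A. if z = x then u z else 0)"
    unfolding kcoord_lincomb using assms by (intro sum.cong) (auto simp: kcoord_kelem)
  also have "\<dots> = (if x \<in> A then u x else 0)" using assms by simp
  finally show ?thesis .
qed

lemma kelem_lincomb_in_Mmod:
  assumes "A \<subseteq> kbasis n k" "1 \<le> k"
  shows "(\<lambda>J. \<Sum>z\<in>A. const (u z) * kelem n z J) \<in> Mmod n k"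
  using assms by (intro Mmod_lincomb) (metis kelem_in_Mmod prod.collapse subsetD)

text \<open>Spanning is read off from duality: both sides lie in the module and have the same
  coordinates, which separate its elements.\<close>

lemma Mmod_expand:
  assumes "y \<in> Mmod n k" "1 \<le> k"
  shows "y = (\<lambda>J. \<Sum>z\<in>{x \<in> kbasis n k. kcoord y x \<noteq> 0}. const (kcoord y z) * kelem n z J)"
proof (rule Mmod_eqI[OF assms(1) _ assms(2)])
  show "(\<lambda>J. \<Sum>z\<in>{x \<in> kbasis n k. kcoord y x \<noteq> 0}. const (kcoord y z) * kelem n z J) \<in> Mmod n k"
    using assms by (intro kelem_lincomb_in_Mmod) auto
  show "kcoord y x = kcoord (\<lambda>J. \<Sum>z\<in>{x \<in> kbasis n k. kcoord y x \<noteq> 0}. const (kcoord y z) * kelem n z J) x"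
    if "x \<in> kbasis n k" for x
    by (subst kcoord_kelem_lincomb[OF finite_kcoord_support _ that assms(2)]) (use that in auto)
qed

text \<open>The Koszul differential has degree zero: X_i e_J and the basis vector for
  \<open>insert i J\<close> sit in the same degree. Both gradings share this property, which lets
  them be treated together.\<close>

definition compatible :: "((nat \<Rightarrow>\<^sub>0 nat) \<Rightarrow> 'd::plus) \<Rightarrow> (nat set \<Rightarrow> 'd) \<Rightarrow> bool" where
  "compatible g e \<longleftrightarrow>
     (\<forall>m i J. finite J \<longrightarrow> i \<notin> J \<longrightarrow> g (single i 1 + m) + e J = g m + e (insert i J))"

lemma compatible_remove:
  assumes "compatible g e" "finite I" "i \<in> I"
  shows "g (single i 1 + m) + e (I - {i}) = g m + e I"
  using assms unfolding compatible_def
  by (metis Diff_iff finite_Diff insertI1 insert_Diff)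

lemma homM_lincomb:
  assumes "\<And>z. z \<in> A \<Longrightarrow> u z \<noteq> 0 \<Longrightarrow> homM g e d (f z)"
  shows "homM g e d (\<lambda>J. \<Sum>z\<in>A. const (u z) * f z J)"
  unfolding homM_def homog_sh_def
proof (intro allI ballI)
  fix J m assume "m \<in> keys (\<Sum>z\<in>A. const (u z) * f z J)"
  then have "(\<Sum>z\<in>A. u z * lookup (f z J) m) \<noteq> 0" by (simp add: in_keys_iff lookup_sum)
  then obtain z where "z \<in> A" "u z * lookup (f z J) m \<noteq> 0" by (rule sum.not_neutral_contains_not_neutral)
  then show "g m + e J = d" using assms[of z] by (auto simp: homM_def homog_sh_def in_keys_iff)
qed

lemma homM_kelem:
  assumes "compatible g e" "I \<subseteq> {..<n}"
  shows "homM g e (g m + e I) (kelem n (I, m) :: nat set \<Rightarrow> ('k::field) mpoly)"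
  unfolding homM_def homog_sh_def
proof (intro allI ballI)
  fix J u assume u: "u \<in> keys (kelem n (I, m) J :: 'k mpoly)"
  then have "kelem n (I, m) J \<noteq> (0 :: 'k mpoly)" by auto
  then obtain i where i: "i \<in> I" "J = I - {i}" using kelem_eq_0 by blast
  with u have "u = single i 1 + m" using assms(2) by (auto simp: kelem_at split: if_splits)
  then show "g u + e J = g m + e I"
    using compatible_remove[OF assms(1) _ i(1), of m] i assms(2) by (auto intro: finite_subset)
qed

text \<open>Basis elements are homogeneous and each coordinate is an actual coefficient of
  \<open>y\<close>, so homogeneity can be tested on coordinates.\<close>

lemma homM_iff_kcoord:
  assumes "compatible g e" "y \<in> Mmod n k" "1 \<le> k"
  shows "homM g e d y \<longleftrightarrow> (\<forall>(I, m)\<in>kbasis n k. kcoord y (I, m) \<noteq> 0 \<longrightarrow> g m + e I = d)"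
proof (intro iffI)
  assume h: "homM g e d y"
  show "\<forall>(I, m)\<in>kbasis n k. kcoord y (I, m) \<noteq> 0 \<longrightarrow> g m + e I = d"
  proof (clarify)
    fix I m assume x: "(I, m) \<in> kbasis n k" "kcoord y (I, m) \<noteq> 0"
    note B = kbasisD[OF x(1) assms(3)]
    from x(2) have "g (single (Min I) 1 + m) + e (I - {Min I}) = d"
      using h by (auto simp: kcoord_def homM_def homog_sh_def in_keys_iff)
    then show "g m + e I = d" using compatible_remove[OF assms(1)] B by auto
  qed
next
  assume *: "\<forall>(I, m)\<in>kbasis n k. kcoord y (I, m) \<noteq> 0 \<longrightarrow> g m + e I = d"
  show "homM g e d y"
  proof (subst Mmod_expand[OF assms(2,3)], rule homM_lincomb)
    fix z assume "z \<in> {x \<in> kbasis n k. kcoord y x \<noteq> 0}"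
    then obtain I m where "z = (I, m)" "(I, m) \<in> kbasis n k" "g m + e I = d" using * by (cases z) auto
    then show "homM g e d (kelem n z)"
      using homM_kelem[OF assms(1), of I n m] kbasisD[of I m n k] assms(3) by auto
  qed
qed

section \<open>Matching subsets\<close>

text \<open>The lattice path of \<open>A\<close>: an element is a step up, a nonelement a step down.
  Turning the step that first reaches the maximum into a step down is the bracketing rule for
  descending in a symmetric chain of subsets.\<close>

definition walk :: "nat set \<Rightarrow> nat \<Rightarrow> int" where
  "walk A i = 2 * int (card (A \<inter> {..<i})) - int i"

lemma walk_Suc: "walk A (Suc i) = walk A i + (if i \<in> A then 1 else - 1)"
proof -
  have "A \<inter> {..<Suc i} = (if i \<in> A then insert i (A \<inter> {..<i}) else A \<inter> {..<i})"
    by (auto simp: less_Suc_eq)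
  then show ?thesis by (simp add: walk_def)
qed

lemma walk_remove:
  assumes "p \<in> A"
  shows "walk (A - {p}) j = walk A j - (if p < j then 2 else 0)"
proof -
  have "A \<inter> {..<j} = (if p < j then insert p ((A - {p}) \<inter> {..<j}) else (A - {p}) \<inter> {..<j})"
    using assms by auto
  then show ?thesis by (simp add: walk_def)
qed

definition last_argmax :: "nat \<Rightarrow> nat set \<Rightarrow> nat \<Rightarrow> bool" where
  "last_argmax n B p \<longleftrightarrow> p \<le> n \<and>
     (\<forall>j\<le>n. walk B j \<le> walk B p) \<and> (\<forall>j\<le>n. p < j \<longrightarrow> walk B j < walk B p)"

lemma last_argmax_unique: "last_argmax n B p \<Longrightarrow> last_argmax n B q \<Longrightarrow> p = q"
  unfolding last_argmax_def by (meson linorder_neqE_nat not_less)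

text \<open>Removing the step that first reaches the maximum of the walk of \<open>A\<close> turns the preceding
  position into the last maximum of the new walk, from which \<open>A\<close> can be recovered.\<close>

lemma ex_removable:
  assumes "A \<subseteq> {..<n}" "n < 2 * card A"
  shows "\<exists>p\<in>A. last_argmax n (A - {p}) p"
proof -
  define Q where "Q i \<longleftrightarrow> i \<le> n \<and> (\<forall>j\<le>n. walk A j \<le> walk A i)" for i
  have "\<exists>i. Q i"
  proof -
    have "Max (walk A ` {..n}) \<in> walk A ` {..n}" by (rule Max_in) auto
    then obtain i where "Max (walk A ` {..n}) = walk A i" "i \<in> {..n}" by (rule imageE)
    moreover have "walk A j \<le> Max (walk A ` {..n})" if "j \<le> n" for j using that by simp
    ultimately show ?thesis unfolding Q_def by (intro exI[of _ i]) simp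
  qed
  then obtain i where i: "Q i" "\<And>j. j < i \<Longrightarrow> \<not> Q j"
    using LeastI_ex[of Q] not_less_Least[of _ Q] by blast
  have less: "walk A j < walk A i" if "j < i" for j
  proof (rule ccontr)
    assume "\<not> walk A j < walk A i"
    then have "Q j" using i(1) that unfolding Q_def by force
    with i(2)[OF that] show False by simp
  qed
  have "A \<inter> {..<n} = A" using assms by auto
  \<comment> \<open>More than \<open>n / 2\<close> elements put the end of the walk above its start,
    so the first maximum is entered by a step up.\<close>
  then have "walk A 0 < walk A n" using assms by (simp add: walk_def)
  then have "i \<noteq> 0" using i(1) unfolding Q_def by (metis le_refl not_less)
  \<comment> \<open>The step belonging to element \<open>p\<close> leads from position
    \<open>p\<close> to position \<open>Suc p\<close>, hence the shift.\<close>
  then obtain p where p: "i = Suc p" by (cases i) auto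
  have "p \<in> A"
    using less[of p] walk_Suc[of A p] by (auto simp: p split: if_splits)
  moreover have "last_argmax n (A - {p}) p"
    unfolding last_argmax_def walk_remove[OF \<open>p \<in> A\<close>]
  proof (intro conjI allI impI)
    have M: "walk A p = walk A i - 1" using walk_Suc[of A p] \<open>p \<in> A\<close> by (simp add: p)
    show "p \<le> n" using i(1) by (simp add: Q_def p)
    fix j assume j: "j \<le> n"
    have le: "walk A j \<le> walk A i" using i(1) j by (simp add: Q_def)
    show "walk A j - (if p < j then 2 else 0) \<le> walk A p - (if p < p then 2 else 0)"
      using M le less[of j] p by auto
    show "walk A j - (if p < j then 2 else 0) < walk A p - (if p < p then 2 else 0)" if "p < j"
      using M le that by auto
  qed
  ultimately show ?thesis by blast
qed

text \<open>A single choice covers all sizes above \<open>n / 2\<close>: the removed point is the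
  last maximum for the remaining set, hence determined by that set.\<close>

lemma ex_matching:
  obtains r where "\<And>A. A \<subseteq> {..<n} \<Longrightarrow> n < 2 * card A \<Longrightarrow> r A \<in> A"
    and "inj_on (\<lambda>A. A - {r A}) {A. A \<subseteq> {..<n} \<and> n < 2 * card A}"
proof
  define r where "r A = (SOME p. p \<in> A \<and> last_argmax n (A - {p}) p)" for A
  have r: "r A \<in> A \<and> last_argmax n (A - {r A}) (r A)" if "A \<subseteq> {..<n}" "n < 2 * card A" for A
    unfolding r_def by (rule someI_ex) (use ex_removable[OF that] in blast)
  show "r A \<in> A" if "A \<subseteq> {..<n}" "n < 2 * card A" for A using r[OF that] by blast
  show "inj_on (\<lambda>A. A - {r A}) {A. A \<subseteq> {..<n} \<and> n < 2 * card A}"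
  proof (rule inj_onI, clarify)
    fix A C assume A: "A \<subseteq> {..<n}" "n < 2 * card A" and C: "C \<subseteq> {..<n}" "n < 2 * card C"
      and eq: "A - {r A} = C - {r C}"
    have "r A = r C" using r[OF A] r[OF C] eq last_argmax_unique by metis
    moreover have "A = insert (r A) (A - {r A})" "C = insert (r C) (C - {r C})"
      using r[OF A] r[OF C] by auto
    ultimately show "A = C" using eq by metis
  qed
qed

text \<open>The sizes k, k + 2, k + 4, ... carry a plus sign in the alternating sum;
  \<open>even_above (Suc k)\<close> collects the sets with a minus sign.\<close>

definition even_above :: "nat \<Rightarrow> nat set \<Rightarrow> nat set set" where
  "even_above k A = {B. B \<subseteq> A \<and> k \<le> card B \<and> even (card B + k)}"

lemma finite_even_above: "finite A \<Longrightarrow> finite (even_above k A)"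
  by (rule finite_subset[of _ "Pow A"]) (auto simp: even_above_def)

text \<open>Toggling \<open>a\<close> exchanges the two parities except for the \<open>k\<close>-sets containing \<open>a\<close>.\<close>

lemma card_even_above:
  assumes "finite A" "a \<in> A"
  shows "card (even_above k A) = card (even_above (Suc k) A) + card {I. I \<subseteq> A \<and> card I = k \<and> a \<in> I}"
proof -
  define tog where "tog B = (if a \<in> B then B - {a} else insert a B)" for B
  let ?E = "even_above k A" and ?K = "{I. I \<subseteq> A \<and> card I = k \<and> a \<in> I}"
  have fin: "finite B" if "B \<subseteq> A" for B using that assms finite_subset by blast
  have tog_card: "card (tog B) = (if a \<in> B then card B - 1 else Suc (card B))"
      "a \<in> B \<Longrightarrow> 0 < card B" if "B \<subseteq> A" for B
    using fin[OF that] by (auto simp: tog_def card_gt_0_iff)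
  have tog_tog: "tog (tog B) = B" for B by (auto simp: tog_def)
  have tog_sub: "tog B \<subseteq> A" if "B \<subseteq> A" for B using that assms by (auto simp: tog_def)
  have a_tog: "a \<in> tog B \<longleftrightarrow> a \<notin> B" for B by (auto simp: tog_def)
  have "bij_betw tog (?E - ?K) (even_above (Suc k) A)"
  proof (rule bij_betw_byWitness[where f' = tog])
    show "tog ` (?E - ?K) \<subseteq> even_above (Suc k) A"
    proof (rule image_subsetI)
      fix B assume B: "B \<in> ?E - ?K"
      then have "B \<subseteq> A" by (simp add: even_above_def)
      moreover have "card B \<noteq> Suc k" using B by (auto simp: even_above_def)
      ultimately show "tog B \<in> even_above (Suc k) A"
        using B tog_card[of B] tog_sub[of B] by (cases "a \<in> B") (auto simp: even_above_def)
    qed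
    show "tog ` even_above (Suc k) A \<subseteq> ?E - ?K"
    proof (rule image_subsetI)
      fix B assume B: "B \<in> even_above (Suc k) A"
      then have "B \<subseteq> A" by (simp add: even_above_def)
      then show "tog B \<in> ?E - ?K"
        using B tog_card[of B] tog_sub[of B] a_tog[of B]
        by (cases "a \<in> B") (auto simp: even_above_def)
    qed
  qed (auto simp: tog_tog)
  then have "card (?E - ?K) = card (even_above (Suc k) A)" by (rule bij_betw_same_card)
  moreover have K: "?K \<subseteq> ?E" by (auto simp: even_above_def)
  moreover have "finite ?K" by (rule finite_subset[OF K finite_even_above[OF assms(1)]])
  ultimately show ?thesis
    using card_Diff_subset[of ?K ?E] card_mono[OF finite_even_above[OF assms(1)] K] by linarith
qed

text \<open>Turns equality of finite dimensions in every degree into a degree-preserving bijection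
  of bases, glued from bijections of the fibres.\<close>

lemma fiberwise_bij:
  assumes "\<And>a. finite {x \<in> X. d x = a}" "\<And>a. finite {y \<in> Y. d' y = a}"
    and "\<And>a. card {x \<in> X. d x = a} = card {y \<in> Y. d' y = a}"
  shows "\<exists>\<beta>. bij_betw \<beta> X Y \<and> (\<forall>x\<in>X. d' (\<beta> x) = d x)"
proof -
  have "\<forall>a. \<exists>h. bij_betw h {x \<in> X. d x = a} {y \<in> Y. d' y = a}"
    using assms finite_same_card_bij by blast
  then obtain h where h: "\<And>a. bij_betw (h a) {x \<in> X. d x = a} {y \<in> Y. d' y = a}" by metis
  define \<beta> where "\<beta> x = h (d x) x" for x
  have \<beta>: "\<beta> x \<in> Y \<and> d' (\<beta> x) = d x" if "x \<in> X" for x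
    using bij_betwE[OF h[of "d x"]] that by (auto simp: \<beta>_def)
  have "inj_on \<beta> X"
  proof (rule inj_onI)
    fix x x' assume x: "x \<in> X" "x' \<in> X" "\<beta> x = \<beta> x'"
    then have "d x = d x'" using \<beta>[of x] \<beta>[of x'] by simp
    then show "x = x'"
      using x bij_betw_imp_inj_on[OF h[of "d x"]] by (auto simp: \<beta>_def dest: inj_onD)
  qed
  moreover have "y \<in> \<beta> ` X" if "y \<in> Y" for y
  proof -
    have "y \<in> h (d' y) ` {x \<in> X. d x = d' y}"
      using bij_betw_imp_surj_on[OF h[of "d' y"]] that by auto
    then obtain x where "y = h (d' y) x" "x \<in> X" "d x = d' y" by blast
    then show ?thesis by (intro image_eqI[of _ _ x]) (simp_all add: \<beta>_def)
  qed
  ultimately have "bij_betw \<beta> X Y" using \<beta> by (auto simp: bij_betw_def)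
  with \<beta> show ?thesis by blast
qed

text \<open>The multidegree of e_I as an exponent vector, so that multidegrees can be compared
  without reference to a grading \<open>g\<close>.\<close>

definition ind :: "nat set \<Rightarrow> nat \<Rightarrow>\<^sub>0 nat" where
  "ind I = (\<Sum>i\<in>I. single i 1)"

lemma lookup_ind: "finite I \<Longrightarrow> lookup (ind I) j = (if j \<in> I then 1 else 0)"
  by (simp add: ind_def lookup_sum lookup_single when_def)

lemma keys_ind: "finite I \<Longrightarrow> keys (ind I) = I"
  by (auto simp: in_keys_iff lookup_ind split: if_splits)

lemma ind_plus_minus:
  assumes "finite I" "I \<subseteq> keys a"
  shows "(a - ind I) + ind I = a"
  using assms
  by (intro poly_mapping_eqI) (auto simp: lookup_add lookup_minus lookup_ind in_keys_iff subset_iff)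

text \<open>In a fixed multidegree the index set determines the monomial, so counting basis elements
  becomes counting sets.\<close>

lemma bij_betw_fst_fiber:
  assumes "\<And>I. I \<in> \<I> \<Longrightarrow> finite I"
  shows "bij_betw fst {(I, m). I \<in> \<I> \<and> P I m \<and> m + ind I = a} {I \<in> \<I>. I \<subseteq> keys a \<and> P I (a - ind I)}"
  unfolding bij_betw_def
proof
  show "inj_on fst {(I, m). I \<in> \<I> \<and> P I m \<and> m + ind I = a}"
    by (rule inj_onI) auto
  show "fst ` {(I, m). I \<in> \<I> \<and> P I m \<and> m + ind I = a} = {I \<in> \<I>. I \<subseteq> keys a \<and> P I (a - ind I)}"
  proof
    show "fst ` {(I, m). I \<in> \<I> \<and> P I m \<and> m + ind I = a} \<subseteq> {I \<in> \<I>. I \<subseteq> keys a \<and> P I (a - ind I)}"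
      using assms by (auto simp: keys_plus_nat keys_ind)
    show "{I \<in> \<I>. I \<subseteq> keys a \<and> P I (a - ind I)} \<subseteq> fst ` {(I, m). I \<in> \<I> \<and> P I m \<and> m + ind I = a}"
    proof clarify
      fix I assume "I \<in> \<I>" "I \<subseteq> keys a" "P I (a - ind I)"
      then show "I \<in> fst ` {(I, m). I \<in> \<I> \<and> P I m \<and> m + ind I = a}"
        using assms ind_plus_minus by (intro image_eqI[of _ _ "(I, a - ind I)"]) auto
    qed
  qed
qed

text \<open>In a multidegree with support \<open>A\<close>, the module contributes the k-subsets of
  \<open>A\<close> that contain its least element. The other side counts
  \<open>even_above k A\<close> without the partners of sets in \<open>even_above (Suc k) A\<close>.
  The two numbers agree by \<open>card_even_above\<close>.\<close>

lemma ex_degree_preserving_bij: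
  assumes "1 \<le> k" "n div 2 \<le> k"
  obtains Z \<beta> where "\<And>B. Z B \<subseteq> {..<n}" "\<And>B. n - 1 \<le> card (Z B)"
    and "bij_betw \<beta> (kbasis n k) {(B, m). B \<in> even_above k {..<n} \<and> keys m \<subseteq> Z B}"
    and "\<And>I m B m'. (I, m) \<in> kbasis n k \<Longrightarrow> \<beta> (I, m) = (B, m') \<Longrightarrow> m' + ind B = m + ind I"
proof -
  let ?C = "{A. A \<subseteq> {..<n} \<and> n < 2 * card A}"
  obtain r where r: "\<And>A. A \<subseteq> {..<n} \<Longrightarrow> n < 2 * card A \<Longrightarrow> r A \<in> A"
    and inj: "inj_on (\<lambda>A. A - {r A}) ?C"
    using ex_matching by blast
  \<comment> \<open>The summand of \<open>B\<close> loses the variable \<open>r C\<close> if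
    \<open>B\<close> is the partner of \<open>C\<close>; injectivity allows at most one such
    \<open>C\<close>.\<close>
  define Z where "Z B = {i \<in> {..<n}. \<not> (\<exists>C\<in>?C. C - {r C} = B \<and> r C = i)}" for B
  let ?Bs = "even_above k {..<n}"
  have Zsub: "Z B \<subseteq> {..<n}" for B by (auto simp: Z_def)
  have Zcard: "n - 1 \<le> card (Z B)" for B
  proof (cases "\<exists>C\<in>?C. C - {r C} = B")
    case True
    then obtain C where C: "C \<in> ?C" "C - {r C} = B" by blast
    have "{..<n} - {r C} \<subseteq> Z B"
      using C inj by (auto simp: Z_def dest: inj_onD)
    then have "card ({..<n} - {r C}) \<le> card (Z B)" using Zsub by (intro card_mono) (auto intro: finite_subset)
    then show ?thesis using C r[of C] by (auto simp: subset_iff)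
  next
    case False
    then have "Z B = {..<n}" by (auto simp: Z_def)
    then show ?thesis by simp
  qed
  have finB: "finite B" if "B \<in> ?Bs" for B using that by (auto simp: even_above_def intro: finite_subset)
  have count: "card {B \<in> ?Bs. B \<subseteq> A \<and> A \<subseteq> Z B} = card {I. I \<subseteq> A \<and> card I = k \<and> a \<in> I}"
    if A: "A \<subseteq> {..<n}" and a: "a \<in> A" for A a
  proof -
    have finA: "finite A" using A finite_subset by blast
    let ?U = "{B \<in> ?Bs. B \<subseteq> A \<and> A \<subseteq> Z B}"
    have E: "even_above k A = {B \<in> ?Bs. B \<subseteq> A}" using A by (auto simp: even_above_def)
    \<comment> \<open>Here the bound on \<open>k\<close> enters: \<open>n div 2 \<le> k\<close> and
      \<open>k < card C\<close> give \<open>n < 2 * card C\<close>.\<close>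
    have C: "C \<in> ?C" if "C \<in> even_above (Suc k) A" for C
      using that assms A by (auto simp: even_above_def)
    have "(\<lambda>C. C - {r C}) ` even_above (Suc k) A = even_above k A - ?U"
    proof (intro equalityI subsetI)
      fix B assume "B \<in> (\<lambda>C. C - {r C}) ` even_above (Suc k) A"
      then obtain C where C': "C \<in> even_above (Suc k) A" "B = C - {r C}" by blast
      have rC: "r C \<in> C" using C[OF C'(1)] r by auto
      have "C \<subseteq> A" "finite C" using C' finA by (auto simp: even_above_def intro: finite_subset)
      then have "B \<in> even_above k A" using C' rC by (auto simp: even_above_def)
      moreover have "r C \<in> A" "r C \<notin> Z B" using C[OF C'(1)] C'(2) rC \<open>C \<subseteq> A\<close> by (auto simp: Z_def)
      ultimately show "B \<in> even_above k A - ?U" by auto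
    next
      fix B assume B: "B \<in> even_above k A - ?U"
      then have "\<not> A \<subseteq> Z B" using E by auto
      then obtain C where C': "C \<in> ?C" "C - {r C} = B" "r C \<in> A" using A by (auto simp: Z_def)
      have "finite C" "r C \<in> C" using C' r by (auto intro: finite_subset)
      then have "C = insert (r C) B" "card C = Suc (card B)"
        using C'(2) card_Suc_Diff1[of C "r C"] by auto
      then have "C \<in> even_above (Suc k) A" using B C' by (auto simp: even_above_def)
      then show "B \<in> (\<lambda>C. C - {r C}) ` even_above (Suc k) A" using C' by blast
    qed
    moreover have "inj_on (\<lambda>C. C - {r C}) (even_above (Suc k) A)"
      by (rule inj_on_subset[OF inj]) (use C in blast)
    ultimately have "card (even_above (Suc k) A) = card (even_above k A - ?U)"
      using card_image by metis
    moreover have U: "?U \<subseteq> even_above k A" using E by auto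
    moreover have "finite ?U" by (rule finite_subset[OF U finite_even_above[OF finA]])
    ultimately show ?thesis
      using card_even_above[OF finA a, of k] card_Diff_subset[of ?U "even_above k A"]
        card_mono[OF finite_even_above[OF finA] U]
      by linarith
  qed
  let ?Y = "{(B, m). B \<in> ?Bs \<and> keys m \<subseteq> Z B}"
  let ?d = "\<lambda>(I, m). m + ind I"
  have fib: "finite {x \<in> kbasis n k. ?d x = a} \<and> finite {y \<in> ?Y. ?d y = a}
      \<and> card {x \<in> kbasis n k. ?d x = a} = card {y \<in> ?Y. ?d y = a}" for a
  proof -
    have finI: "finite I" if "I \<in> ksubs n k" for I using that by (auto simp: ksubs_def intro: finite_subset)
    let ?F1 = "{I \<in> ksubs n k. I \<subseteq> keys a \<and> keys (a - ind I) \<subseteq> {Min I..<n}}"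
    let ?F2 = "{B \<in> ?Bs. B \<subseteq> keys a \<and> keys (a - ind B) \<subseteq> Z B}"
    have b1: "bij_betw fst {x \<in> kbasis n k. ?d x = a} ?F1"
      using bij_betw_fst_fiber[of "ksubs n k" "\<lambda>I m. keys m \<subseteq> {Min I..<n}" a, OF finI]
      by (auto simp: kbasis_def intro: back_subst[of "\<lambda>X. bij_betw fst X ?F1"])
    have b2: "bij_betw fst {y \<in> ?Y. ?d y = a} ?F2"
      using bij_betw_fst_fiber[of ?Bs "\<lambda>B m. keys m \<subseteq> Z B" a, OF finB]
      by (auto intro: back_subst[of "\<lambda>X. bij_betw fst X ?F2"])
    have keys_a: "keys a = keys (a - ind I) \<union> I" if "I \<subseteq> keys a" for I
    proof -
      have "finite I" using finite_subset[OF that finite_keys] .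
      then show ?thesis using keys_plus_nat[of "a - ind I" "ind I"] that by (simp add: ind_plus_minus keys_ind)
    qed
    have f: "finite ?F1" "finite ?F2" using finite_ksubs finite_even_above by auto
    \<comment> \<open>Only the support of \<open>a\<close> matters. If it is empty, or contains a
      variable outside the ring, both sides are empty; the former uses
      \<open>1 \<le> k\<close>.\<close>
    have "card ?F1 = card ?F2"
    proof (cases "keys a \<noteq> {} \<and> keys a \<subseteq> {..<n}")
      case True
      let ?a = "Min (keys a)"
      have a: "?a \<in> keys a" using True by (intro Min_in) auto
      \<comment> \<open>The least variable of \<open>a\<close> lies in \<open>I\<close> or in the
        remaining monomial, whose variables are at least \<open>Min I\<close>; so it equals
        \<open>Min I\<close>.\<close>
      have "?F1 = {I. I \<subseteq> keys a \<and> card I = k \<and> ?a \<in> I}"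
      proof (intro equalityI subsetI)
        fix I assume I: "I \<in> ?F1"
        then have fI: "finite I" using finI by simp
        have "card I = k" using I by (simp add: ksubs_def)
        then have ne: "I \<noteq> {}" using assms(1) by auto
        have sub: "I \<subseteq> keys a" "keys (a - ind I) \<subseteq> {Min I..<n}" using I by simp_all
        have "?a \<in> keys (a - ind I) \<union> I" using a keys_a[OF sub(1)] by simp
        then have "Min I \<le> ?a" using sub(2) fI by auto
        moreover have "Min I \<in> I" using fI ne by simp
        then have "?a \<le> Min I" using sub(1) by (intro Min_le) auto
        ultimately have "?a = Min I" by simp
        then show "I \<in> {I. I \<subseteq> keys a \<and> card I = k \<and> ?a \<in> I}"
          using sub \<open>Min I \<in> I\<close> \<open>card I = k\<close> by simp
      next
        fix I assume I: "I \<in> {I. I \<subseteq> keys a \<and> card I = k \<and> ?a \<in> I}"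
        then have fI: "finite I" using finite_subset[OF _ finite_keys, of I a] by simp
        then have "Min I = ?a" using I by (intro Min_eqI) auto
        moreover have "keys (a - ind I) \<subseteq> keys a" using keys_a[of I] I by blast
        moreover have "keys a \<subseteq> {?a..<n}" using True by auto
        ultimately show "I \<in> ?F1" using I True by (auto simp: ksubs_def)
      qed
      moreover have "?F2 = {B \<in> ?Bs. B \<subseteq> keys a \<and> keys a \<subseteq> Z B}"
      proof -
        \<comment> \<open>\<open>B\<close> never loses one of its own variables, because
          \<open>r C\<close> is not in \<open>C - {r C}\<close>.\<close>
        have "B \<subseteq> Z B" if "B \<in> ?Bs" for B using that by (auto simp: Z_def even_above_def)
        then show ?thesis using keys_a by blast
      qed
      ultimately show ?thesis using count[of "keys a" ?a] True a by simp
    next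
      case False
      have "?F1 = {}"
      proof (rule ccontr)
        assume "?F1 \<noteq> {}"
        then obtain I where "I \<in> ksubs n k" "I \<subseteq> keys a" "keys (a - ind I) \<subseteq> {Min I..<n}" by blast
        then show False using False keys_a[of I] assms(1) by (auto simp: ksubs_def)
      qed
      moreover have "?F2 = {}"
      proof (rule ccontr)
        assume "?F2 \<noteq> {}"
        then obtain B where "B \<in> ?Bs" "B \<subseteq> keys a" "keys (a - ind B) \<subseteq> Z B" by blast
        then show False using False keys_a[of B] assms(1) Zsub[of B] by (auto simp: even_above_def)
      qed
      ultimately show ?thesis by (simp only:)
    qed
    then show ?thesis
      using bij_betw_finite[OF b1] bij_betw_finite[OF b2] bij_betw_same_card[OF b1]
        bij_betw_same_card[OF b2] f by (simp only: simp_thms)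
  qed
  have "\<exists>\<beta>. bij_betw \<beta> (kbasis n k) ?Y \<and> (\<forall>x\<in>kbasis n k. ?d (\<beta> x) = ?d x)"
    by (rule fiberwise_bij) (use fib in blast)+
  then obtain \<beta> where \<beta>: "bij_betw \<beta> (kbasis n k) ?Y" "\<forall>x\<in>kbasis n k. ?d (\<beta> x) = ?d x"
    by (elim exE conjE)
  have "m' + ind B = m + ind I" if "(I, m) \<in> kbasis n k" "\<beta> (I, m) = (B, m')" for I m B m'
    using bspec[OF \<beta>(2) that(1)] that(2) by simp
  with Zsub Zcard \<beta>(1) show thesis using that by blast
qed

section \<open>Hilbert decompositions of the syzygy module\<close>

text \<open>Hence \<open>g m + e I\<close> depends only on the multidegree \<open>m + ind I\<close>,
  and a bijection that preserves multidegrees preserves degrees for every compatible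
  grading.\<close>

lemma compatible_ind:
  assumes "compatible g e" "finite I"
  shows "g (m + ind I) + e {} = g m + e I"
  using assms(2)
proof (induction I arbitrary: m)
  case empty
  then show ?case by (simp add: ind_def)
next
  case (insert i I)
  have "g (m + ind (insert i I)) + e {} = g ((single i 1 + m) + ind I) + e {}"
    using insert.hyps by (simp add: ind_def ac_simps)
  also have "\<dots> = g (single i 1 + m) + e I" by (rule insert.IH)
  also have "\<dots> = g m + e (insert i I)" using assms(1) insert.hyps by (simp add: compatible_def)
  finally show ?case .
qed

text \<open>Coordinates are carried over along the bijection of monomial bases; the summands are the
  polynomial rings in the variables \<open>Z B\<close>, shifted by \<open>e B\<close>.\<close>

lemma ex_hilbert_decomp:
  fixes g :: "(nat \<Rightarrow>\<^sub>0 nat) \<Rightarrow> 'd::monoid_add"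
  assumes comp: "compatible g e" and k: "1 \<le> k" "n div 2 \<le> k" "k < n"
    and Deg: "\<And>B. B \<subseteq> {..<n} \<Longrightarrow> e B \<in> Deg"
  obtains D where "hilbert_decomp g e Deg n (Mmod n k :: (nat set \<Rightarrow> ('k::field) mpoly) set) D"
    and "D \<noteq> []" "\<And>S s. (S, s) \<in> set D \<Longrightarrow> n - 1 \<le> krull_dim S"
proof -
  obtain Z \<beta> where Z: "\<And>B. Z B \<subseteq> {..<n}" "\<And>B. n - 1 \<le> card (Z B)"
    and \<beta>: "bij_betw \<beta> (kbasis n k) {(B, m). B \<in> even_above k {..<n} \<and> keys m \<subseteq> Z B}"
    and deg: "\<And>I m B m'. (I, m) \<in> kbasis n k \<Longrightarrow> \<beta> (I, m) = (B, m') \<Longrightarrow> m' + ind B = m + ind I"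
    using ex_degree_preserving_bij[OF k(1,2)] by blast
  let ?Y = "{(B, m). B \<in> even_above k {..<n} \<and> keys m \<subseteq> Z B}"
  define \<gamma> where "\<gamma> = inv_into (kbasis n k) \<beta>"
  have \<gamma>: "\<gamma> y \<in> kbasis n k" "\<beta> (\<gamma> y) = y" if "y \<in> ?Y" for y
    using that bij_betw_inv_into_right[OF \<beta> that] bij_betwE[OF bij_betw_inv_into[OF \<beta>]]
    unfolding \<gamma>_def by blast+
  have \<gamma>\<beta>: "\<gamma> (\<beta> x) = x" if "x \<in> kbasis n k" for x
    using bij_betw_inv_into_left[OF \<beta> that] by (simp add: \<gamma>_def)
  have \<beta>Y: "\<beta> x \<in> ?Y" if "x \<in> kbasis n k" for x using bij_betwE[OF \<beta>] that by (rule bspec)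
  have fin: "finite B" if "B \<subseteq> {..<n}" for B using that finite_subset by blast
  have deg_eq: "g m' + e B = g m + e I" if "(I, m) \<in> kbasis n k" "\<beta> (I, m) = (B, m')" for I m B m'
  proof -
    have "I \<subseteq> {..<n}" "B \<subseteq> {..<n}"
      using kbasisD(1)[OF that(1) k(1)] \<beta>Y[OF that(1)] that(2) by (auto simp: even_above_def)
    then have "g m' + e B = g (m' + ind B) + e {}" "g m + e I = g (m + ind I) + e {}"
      using compatible_ind[OF comp] fin by metis+
    then show ?thesis using deg[OF that] by simp
  qed
  obtain L where L: "set L = even_above k {..<n}" "distinct L"
    using finite_distinct_list[OF finite_even_above[of "{..<n}" k]] by auto
  define idx where "idx = inv_into {..<length L} ((!) L)"
  have idx: "idx (L ! j) = j" if "j < length L" for j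
    unfolding idx_def using that L(2) by (intro inv_into_f_f) (auto simp: inj_on_def nth_eq_iff_index_eq)
  define D where "D = map (\<lambda>B. (ppoly (Z B) :: 'k mpoly set, e B)) L"
  have len: "length D = length L" by (simp add: D_def)
  have Dj: "D ! j = (ppoly (Z (L ! j)), e (L ! j))" if "j < length L" for j
    using that by (simp add: D_def)
  have LY: "(L ! j, m) \<in> ?Y" if "j < length L" "keys m \<subseteq> Z (L ! j)" for j m
    using that nth_mem[OF that(1)] L(1) by simp
  define f :: "(nat set \<Rightarrow> 'k mpoly) \<Rightarrow> nat \<Rightarrow> 'k mpoly" where
    "f y j = (if j < length L then Abs_poly_mapping (\<lambda>m. if keys m \<subseteq> Z (L ! j)
       then kcoord y (\<gamma> (L ! j, m)) else 0) else 0)" for y j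
  \<comment> \<open>\<open>Abs_poly_mapping\<close> is meaningful only for finite support, which
    comes from the finitely many nonzero coordinates of \<open>y\<close>.\<close>
  have look: "lookup (f y j) m = (if keys m \<subseteq> Z (L ! j) then kcoord y (\<gamma> (L ! j, m)) else 0)"
    if "j < length L" for y j m
  proof -
    have "{m. (if keys m \<subseteq> Z (L ! j) then kcoord y (\<gamma> (L ! j, m)) else 0) \<noteq> 0}
        \<subseteq> (\<lambda>x. snd (\<beta> x)) ` {x \<in> kbasis n k. kcoord y x \<noteq> 0}"
    proof
      fix m assume "m \<in> {m. (if keys m \<subseteq> Z (L ! j) then kcoord y (\<gamma> (L ! j, m)) else 0) \<noteq> 0}"
      then have m: "keys m \<subseteq> Z (L ! j)" "kcoord y (\<gamma> (L ! j, m)) \<noteq> 0" by (auto split: if_splits)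
      note Y = \<gamma>[OF LY[OF that m(1)]]
      show "m \<in> (\<lambda>x. snd (\<beta> x)) ` {x \<in> kbasis n k. kcoord y x \<noteq> 0}"
        by (rule image_eqI[of _ _ "\<gamma> (L ! j, m)"]) (use m Y in auto)
    qed
    then have "finite {m. (if keys m \<subseteq> Z (L ! j) then kcoord y (\<gamma> (L ! j, m)) else 0) \<noteq> 0}"
      by (rule finite_subset) (intro finite_imageI finite_kcoord_support)
    then show ?thesis using that by (simp add: f_def)
  qed
  have f0: "f y j = 0" if "\<not> j < length L" for y j using that by (simp add: f_def)
  have f_eqI: "f y = v" if "\<And>j m. j < length L \<Longrightarrow> lookup (f y j) m = lookup (v j) m"
    "\<And>j. \<not> j < length L \<Longrightarrow> v j = 0" for y v
  proof
    fix j show "f y j = v j"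
      using that f0[of j y] by (cases "j < length L") (auto intro: poly_mapping_eqI)
  qed
  have index: "\<exists>j<length L. \<exists>m. \<beta> x = (L ! j, m) \<and> keys m \<subseteq> Z (L ! j)" if x: "x \<in> kbasis n k" for x
  proof -
    obtain B m where "\<beta> x = (B, m)" "B \<in> set L" "keys m \<subseteq> Z B"
      using \<beta>Y[OF x] L(1) by auto
    then show ?thesis by (metis in_set_conv_nth)
  qed
  have coord: "\<exists>j<length L. \<exists>m. \<beta> x = (L ! j, m) \<and> (\<forall>y. kcoord y x = lookup (f y j) m)"
    if x: "x \<in> kbasis n k" for x
  proof -
    obtain j m where jm: "j < length L" "\<beta> x = (L ! j, m)" "keys m \<subseteq> Z (L ! j)" using index[OF x] by blast
    have "\<gamma> (L ! j, m) = x" using \<gamma>\<beta>[OF x] jm(2) by simp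
    then show ?thesis using jm by (intro exI[of _ j] exI[of _ m] conjI) (auto simp: look)
  qed
  have "graded_iso g e (Mmod n k) D f"
    unfolding graded_iso_def
  proof (intro conjI ballI allI)
    show "bij_betw f (Mmod n k) (dsum D)"
      unfolding bij_betw_def
    proof (intro conjI equalityI subsetI)
      show "inj_on f (Mmod n k)"
      proof (rule inj_onI)
        fix y z :: "nat set \<Rightarrow> 'k mpoly"
        assume yz: "y \<in> Mmod n k" "z \<in> Mmod n k" "f y = f z"
        show "y = z"
        proof (rule Mmod_eqI[OF yz(1,2) k(1)])
          fix x assume "x \<in> kbasis n k"
          from coord[OF this] show "kcoord y x = kcoord z x" using yz(3) by auto
        qed
      qed
    next
      fix v assume "v \<in> f ` Mmod n k"
      then show "v \<in> dsum D"
        by (auto simp: dsum_def len Dj f0 ppoly_iff intro!: poly_mapping_eqI)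
          (auto simp: lookup_restr look)
    next
      fix v assume v: "v \<in> dsum D"
      have vj: "v j \<in> ppoly (Z (L ! j))" if "j < length L" for j
        using v that by (auto simp: dsum_def len Dj)
      \<comment> \<open>The basis indices that correspond to the monomials occurring in
        \<open>v\<close>; \<open>u\<close> then gives them the coefficients of
        \<open>v\<close>.\<close>
      define A where "A = (\<Union>j<length L. (\<lambda>m. \<gamma> (L ! j, m)) ` keys (v j))"
      have vk: "keys m \<subseteq> Z (L ! j)" if "j < length L" "m \<in> keys (v j)" for j m
        using vj that by (auto simp: ppoly_def)
      have A: "finite A" "A \<subseteq> kbasis n k"
        unfolding A_def using \<gamma>(1)[OF LY] vk by auto
      define u where "u z = lookup (v (idx (fst (\<beta> z)))) (snd (\<beta> z))" for z
      define y where "y = (\<lambda>J. \<Sum>z\<in>A. const (u z) * (kelem n z J :: 'k mpoly))"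
      have "y \<in> Mmod n k" unfolding y_def by (rule kelem_lincomb_in_Mmod[OF A(2) k(1)])
      moreover have "f y = v"
      proof (rule f_eqI)
        fix j m assume j: "j < length L"
        show "lookup (f y j) m = lookup (v j) m"
        proof (cases "keys m \<subseteq> Z (L ! j)")
          case True
          note Y = \<gamma>[OF LY[OF j True]]
          have u: "u (\<gamma> (L ! j, m)) = lookup (v j) m" by (simp add: u_def Y idx[OF j])
          have "lookup (f y j) m = (if \<gamma> (L ! j, m) \<in> A then lookup (v j) m else 0)"
            unfolding look[OF j] y_def using True by (simp add: kcoord_kelem_lincomb[OF A Y(1) k(1)] u)
          moreover have "\<gamma> (L ! j, m) \<in> A" if "m \<in> keys (v j)" using that j by (auto simp: A_def)
          ultimately show ?thesis by (auto simp: in_keys_iff)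
        next
          case False
          then have "m \<notin> keys (v j)" using vk[OF j] by blast
          then show ?thesis using False by (simp add: look[OF j] in_keys_iff)
        qed
      next
        fix j assume "\<not> j < length L"
        then show "v j = 0" using v by (auto simp: dsum_def len)
      qed
      ultimately show "v \<in> f ` Mmod n k" by blast
    qed
  next
    fix a b :: "nat set \<Rightarrow> 'k mpoly"
    show "f (\<lambda>I. a I + b I) = (\<lambda>i. f a i + f b i)"
      by (rule f_eqI) (auto simp: look lookup_add kcoord_add f0)
  next
    fix a :: "nat set \<Rightarrow> 'k mpoly" and c :: 'k
    show "f (\<lambda>I. const c * a I) = (\<lambda>i. const c * f a i)"
      by (rule f_eqI) (auto simp: look kcoord_def f0)
  next
    fix y :: "nat set \<Rightarrow> 'k mpoly" and d assume y: "y \<in> Mmod n k"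
    show "homM g e d y \<longleftrightarrow> homD g D d (f y)"
      unfolding homM_iff_kcoord[OF comp y k(1)]
    proof
      assume h: "\<forall>(I, m)\<in>kbasis n k. kcoord y (I, m) \<noteq> 0 \<longrightarrow> g m + e I = d"
      show "homD g D d (f y)"
        unfolding homD_def homog_sh_def len
      proof (intro allI impI ballI)
        fix j m assume j: "j < length L" and "m \<in> keys (f y j)"
        then have m: "keys m \<subseteq> Z (L ! j)" "kcoord y (\<gamma> (L ! j, m)) \<noteq> 0"
          by (auto simp: in_keys_iff[of m] look[OF j] split: if_splits)
        note Y = \<gamma>[OF LY[OF j m(1)]]
        obtain I m' where x: "\<gamma> (L ! j, m) = (I, m')" by fastforce
        have "g m' + e I = d" using h Y(1) m(2) x by auto
        then show "g m + snd (D ! j) = d" using deg_eq[of I m' "L ! j" m] Y x by (simp add: Dj[OF j])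
      qed
    next
      assume h: "homD g D d (f y)"
      show "\<forall>(I, m)\<in>kbasis n k. kcoord y (I, m) \<noteq> 0 \<longrightarrow> g m + e I = d"
      proof clarify
        fix I m assume x: "(I, m) \<in> kbasis n k" "kcoord y (I, m) \<noteq> 0"
        obtain j m' where j: "j < length L" "\<beta> (I, m) = (L ! j, m')" "kcoord y (I, m) = lookup (f y j) m'"
          using coord[OF x(1)] by blast
        then have "g m' + snd (D ! j) = d"
          using h x(2) unfolding homD_def homog_sh_def len by (metis in_keys_iff)
        then show "g m + e I = d" using deg_eq[OF x(1) j(2)] by (simp add: Dj[OF j(1)])
      qed
    qed
  qed
  moreover have "graded_retract g n S \<and> s \<in> Deg" if "(S, s) \<in> set D" for S s
    using that Deg L(1) graded_retract_ppoly[OF Z(1)] by (auto simp: D_def even_above_def)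
  ultimately have "hilbert_decomp g e Deg n (Mmod n k) D"
    unfolding hilbert_decomp_def by auto
  \<comment> \<open>The depth is a minimum over the list, so the list has to be nonempty.\<close>
  moreover have "{..<k} \<in> even_above k {..<n}" using k by (auto simp: even_above_def)
  then have "D \<noteq> []" using L(1) by (auto simp: D_def)
  moreover have "n - 1 \<le> krull_dim S" if S: "(S, s) \<in> set D" for S s
  proof -
    obtain B where "S = ppoly (Z B)" using S by (auto simp: D_def)
    then show ?thesis using order_trans[OF Z(2) krull_dim_ppoly_ge[OF fin[OF Z(1)]]] by simp
  qed
  ultimately show thesis by (rule that)
qed

section \<open>The syzygy module is not free\<close>

definition tdeg :: "(nat \<Rightarrow>\<^sub>0 nat) \<Rightarrow> nat" where
  "tdeg m = (\<Sum>i\<in>keys m. lookup m i)"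

lemma tdeg_superset: "finite A \<Longrightarrow> keys m \<subseteq> A \<Longrightarrow> tdeg m = (\<Sum>i\<in>A. lookup m i)"
  unfolding tdeg_def by (intro sum.mono_neutral_left) (auto simp: in_keys_iff)

lemma lookup_le_tdeg: "lookup m i \<le> tdeg m"
  by (cases "i \<in> keys m") (auto simp: tdeg_def in_keys_iff intro: member_le_sum)

lemma tdeg_add: "tdeg (m + m') = tdeg m + tdeg m'"
  using tdeg_superset[of "keys m \<union> keys m'" m] tdeg_superset[of "keys m \<union> keys m'" m']
    tdeg_superset[of "keys m \<union> keys m'" "m + m'"]
  by (simp add: keys_plus_nat lookup_add sum.distrib)

lemma tdeg_single [simp]: "tdeg (single i t) = t"
  by (simp add: tdeg_def)

lemma tdeg_0 [simp]: "tdeg 0 = 0"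
  by (simp add: tdeg_def)

lemma tdeg_eq_0_iff: "tdeg m = 0 \<longleftrightarrow> m = 0"
proof
  assume "tdeg m = 0"
  then show "m = 0" using lookup_le_tdeg[of m] by (intro poly_mapping_eqI) simp
qed simp

lemma tdeg_eq_1: "tdeg m = 1 \<Longrightarrow> \<exists>i. m = single i 1"
proof -
  assume m: "tdeg m = 1"
  then have "m \<noteq> 0" using tdeg_eq_0_iff[of m] by auto
  then obtain i where "i \<in> keys m" using poly_mapping_eqI[of m 0] by (auto simp: in_keys_iff)
  note e = single_plus_minus[OF this]
  have "tdeg (single i 1) + tdeg (m - single i 1) = 1" using m e by (simp only: tdeg_add[symmetric])
  then have "m - single i 1 = 0" by (simp add: tdeg_eq_0_iff)
  then show ?thesis using e by (metis add.right_neutral)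
qed

lemma finite_tdeg_le: "finite {m. keys m \<subseteq> {..<n} \<and> tdeg m \<le> t}" (is "finite ?A")
proof (rule inj_on_finite)
  show "inj_on (\<lambda>m. restrict (lookup m) {..<n}) ?A"
  proof (rule inj_onI, rule poly_mapping_eqI)
    fix m m' i assume m: "m \<in> ?A" "m' \<in> ?A" "restrict (lookup m) {..<n} = restrict (lookup m') {..<n}"
    show "lookup m i = lookup m' i"
    proof (cases "i < n")
      case True
      then show ?thesis using fun_cong[OF m(3), of i] by simp
    next
      case False
      then have "i \<notin> keys m" "i \<notin> keys m'" using m by auto
      then show ?thesis by (simp add: in_keys_iff)
    qed
  qed
  show "(\<lambda>m. restrict (lookup m) {..<n}) ` ?A \<subseteq> {..<n} \<rightarrow>\<^sub>E {..t}"
    by (rule image_subsetI) (simp add: restrict_PiE_iff order_trans[OF lookup_le_tdeg])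
  show "finite ({..<n} \<rightarrow>\<^sub>E {..t})" by (simp add: finite_PiE)
qed

text \<open>If all summands were free, the \<open>card (ksubs n k)\<close> generators in degree \<open>k\<close> would produce
  \<open>n * card (ksubs n k)\<close> independent elements of degree \<open>k + 1\<close>, too many by the monomial basis.\<close>

lemma no_free_decomposition:
  fixes g :: "(nat \<Rightarrow>\<^sub>0 nat) \<Rightarrow> 'd::monoid_add" and h :: "'d \<Rightarrow> int"
    and D :: "(('k::field) mpoly set \<times> 'd) list"
  assumes comp: "compatible g e" and k: "1 \<le> k" "k < n"
    and h: "\<And>m s. keys m \<subseteq> {..<n} \<Longrightarrow> h (g m + s) = int (tdeg m) + h s"
    and he: "\<And>I. I \<subseteq> {..<n} \<Longrightarrow> h (e I) = int (card I)"
    and free: "\<And>j. j < length D \<Longrightarrow> fst (D ! j) = polyR n"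
  shows "\<not> graded_iso g e (Mmod n k) D f"
proof
  assume iso: "graded_iso g e (Mmod n k) D f"
  let ?M = "Mmod n k :: (nat set \<Rightarrow> 'k mpoly) set"
  have bij: "bij_betw f ?M (dsum D)"
    and f_add: "\<And>a b. a \<in> ?M \<Longrightarrow> b \<in> ?M \<Longrightarrow> f (\<lambda>I. a I + b I) = (\<lambda>i. f a i + f b i)"
    and f_scale: "\<And>a c. a \<in> ?M \<Longrightarrow> f (\<lambda>I. const c * a I) = (\<lambda>i. const c * f a i)"
    and f_hom: "\<And>a d. a \<in> ?M \<Longrightarrow> homM g e d a \<longleftrightarrow> homD g D d (f a)"
    using iso by (auto simp: graded_iso_def)
  have f_zero: "f (\<lambda>I. 0) = (\<lambda>i. 0)" using f_scale[OF Mmod_0, of 0] by simp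
  have f_lin: "f (\<lambda>I. \<Sum>z\<in>A. const (u z) * b z I) = (\<lambda>j. \<Sum>z\<in>A. const (u z) * f (b z) j)"
    if "finite A" "\<And>z. z \<in> A \<Longrightarrow> b z \<in> ?M" for A :: "'z set" and u b
    using that
  proof (induction A)
    case (insert z A)
    have "f (\<lambda>I. const (u z) * b z I + (\<Sum>z\<in>A. const (u z) * b z I))
        = (\<lambda>j. f (\<lambda>I. const (u z) * b z I) j + f (\<lambda>I. \<Sum>z\<in>A. const (u z) * b z I) j)"
      using insert.prems by (intro f_add Mmod_scale Mmod_lincomb) auto
    then show ?case using insert by (simp add: f_scale)
  qed (simp add: f_zero)
  have f_inj: "y = z" if "y \<in> ?M" "z \<in> ?M" "f y = f z" for y z
    using inj_onD[OF bij_betw_imp_inj_on[OF bij]] that by blast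
  let ?N = "{(j, m). j < length D \<and> keys m \<subseteq> {..<n}}"
  \<comment> \<open>Degrees of the basis elements on the two sides. After \<open>h\<close> coarsens
    them to integers, still only finitely many elements share a degree.\<close>
  define dM where "dM = (\<lambda>(I, m). g m + e I)"
  define dF where "dF = (\<lambda>(j, m). g m + snd (D ! j))"
  have hM: "h (dM (I, m)) = int (tdeg m) + int k" if "(I, m) \<in> kbasis n k" for I m
    using h he kbasisD[OF that k(1)] by (simp add: dM_def)
  have hF: "h (dF (j, m)) = int (tdeg m) + h (snd (D ! j))" if "(j, m) \<in> ?N" for j m
    using h that by (simp add: dF_def)
  have finM: "finite {x \<in> kbasis n k. h (dM x) = t}" for t
  proof (rule finite_subset)
    show "{x \<in> kbasis n k. h (dM x) = t} \<subseteq> ksubs n k \<times> {m. keys m \<subseteq> {..<n} \<and> tdeg m \<le> nat t}"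
    proof
      fix x assume x: "x \<in> {x \<in> kbasis n k. h (dM x) = t}"
      obtain I m where Im: "x = (I, m)" by (cases x)
      then have B: "(I, m) \<in> kbasis n k" "h (dM (I, m)) = t" using x by auto
      then have "tdeg m \<le> nat t" using hM by fastforce
      then show "x \<in> ksubs n k \<times> {m. keys m \<subseteq> {..<n} \<and> tdeg m \<le> nat t}"
        using kbasisD[OF B(1) k(1)] by (simp add: Im ksubs_def)
    qed
  qed (auto simp: finite_ksubs finite_tdeg_le)
  have finF: "finite {y \<in> ?N. h (dF y) = t}" for t
  proof (rule finite_subset)
    show "{y \<in> ?N. h (dF y) = t} \<subseteq> Sigma {..<length D}
        (\<lambda>j. {m. keys m \<subseteq> {..<n} \<and> tdeg m \<le> nat (t - h (snd (D ! j)))})"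
      using hF by fastforce
  qed (auto simp: finite_tdeg_le)
  have finM': "finite {x \<in> kbasis n k. dM x = d}" for d
    by (rule finite_subset[OF _ finM[of "h d"]]) auto
  have finF': "finite {y \<in> ?N. dF y = d}" for d
    by (rule finite_subset[OF _ finF[of "h d"]]) auto
  \<comment> \<open>Otherwise a nontrivial combination of basis elements of degree \<open>d\<close>
    has an image with no coefficient in that degree; being homogeneous of degree \<open>d\<close>,
    the image vanishes, against injectivity.\<close>
  have le1: "card {x \<in> kbasis n k. dM x = d} \<le> card {y \<in> ?N. dF y = d}" for d
  proof (rule ccontr)
    let ?A = "{x \<in> kbasis n k. dM x = d}" and ?B = "{y \<in> ?N. dF y = d}"
    assume "\<not> card ?A \<le> card ?B"
    then have "card ?B < card ?A" by simp
    from homogeneous_system_nontrivial_solution[OF finF' finM' this,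
        of "\<lambda>x y. lookup (f (kelem n x) (fst y)) (snd y)"]
    obtain u :: "_ \<Rightarrow> 'k" where u: "\<exists>x\<in>?A. u x \<noteq> 0"
      "\<forall>y\<in>?B. (\<Sum>x\<in>?A. u x * lookup (f (kelem n x) (fst y)) (snd y)) = 0" by blast
    define y where "y = (\<lambda>J. \<Sum>x\<in>?A. const (u x) * (kelem n x J :: 'k mpoly))"
    have kM: "kelem n x \<in> ?M" if "x \<in> ?A" for x
      using that kelem_in_Mmod[of "fst x" "snd x" n k] k(1) by simp
    have yM: "y \<in> ?M" unfolding y_def by (rule kelem_lincomb_in_Mmod[OF _ k(1)]) auto
    have fy: "f y = (\<lambda>j. \<Sum>x\<in>?A. const (u x) * f (kelem n x) j)"
      unfolding y_def using kM by (intro f_lin finM')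
    have "homM g e d y"
      unfolding y_def
    proof (rule homM_lincomb)
      fix x assume "x \<in> ?A"
      then obtain I m where x: "x = (I, m)" "(I, m) \<in> kbasis n k" "g m + e I = d"
        by (cases x) (auto simp: dM_def)
      then show "homM g e d (kelem n x)" using homM_kelem[OF comp, of I n m] kbasisD[OF x(2) k(1)] by simp
    qed
    then have hD: "homD g D d (f y)" using f_hom[OF yM] by simp
    have dsum: "f y \<in> dsum D" using bij_betwE[OF bij] yM by blast
    have "f y j = 0" for j
    proof (cases "j < length D")
      case True
      show ?thesis
      proof (rule poly_mapping_eqI, rule ccontr)
        fix m assume nz: "lookup (f y j) m \<noteq> lookup 0 m"
        then have m: "m \<in> keys (f y j)" by (simp add: in_keys_iff)
        have "f y j \<in> polyR n" using dsum True free[OF True] by (auto simp: dsum_def)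
        then have "keys m \<subseteq> {..<n}" using m by (auto simp: polyR_def)
        moreover have "g m + snd (D ! j) = d" using hD m True by (auto simp: homD_def homog_sh_def)
        ultimately have "(j, m) \<in> ?B" using True by (simp add: dF_def)
        with u(2) have "lookup (f y j) m = 0" by (auto simp: fy lookup_sum)
        with nz show False by simp
      qed
    next
      case False
      then show ?thesis using dsum by (auto simp: dsum_def)
    qed
    then have "f y = f (\<lambda>I. 0)" using f_zero by auto
    then have y0: "y = (\<lambda>I. 0)" by (rule f_inj[OF yM Mmod_0])
    have "u x = 0" if "x \<in> ?A" for x
    proof -
      have "kcoord y x = u x"
        unfolding y_def using kcoord_kelem_lincomb[OF finM'[of d], of n k x u] that k(1) by auto
      then show ?thesis by (simp add: y0 kcoord_def)
    qed
    with u(1) show False by blast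
  qed
  \<comment> \<open>The same argument for the inverse of \<open>f\<close>, applied to the monomials
    of the free summands.\<close>
  have le2: "card {y \<in> ?N. dF y = d} \<le> card {x \<in> kbasis n k. dM x = d}" for d
  proof (rule ccontr)
    let ?A = "{y \<in> ?N. dF y = d}" and ?B = "{x \<in> kbasis n k. dM x = d}"
    assume "\<not> card ?A \<le> card ?B"
    then have less: "card ?B < card ?A" by simp
    define unit :: "nat \<times> (nat \<Rightarrow>\<^sub>0 nat) \<Rightarrow> nat \<Rightarrow> 'k mpoly" where
      "unit p = (\<lambda>j. if j = fst p then single (snd p) 1 else 0)" for p
    have "\<forall>p\<in>?A. \<exists>b. b \<in> ?M \<and> f b = unit p"
    proof
      fix p assume that: "p \<in> ?A"
      have "unit p \<in> dsum D"
        using that free by (auto simp: unit_def dsum_def polyR_eq_ppoly ppoly_single ppoly_0)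
      then have "unit p \<in> f ` ?M" unfolding bij_betw_imp_surj_on[OF bij] .
      then show "\<exists>b. b \<in> ?M \<and> f b = unit p" by force
    qed
    from bchoice[OF this] obtain b where "\<forall>p\<in>?A. b p \<in> ?M \<and> f (b p) = unit p"
      by (rule exE)
    note b = bspec[OF this]
    from homogeneous_system_nontrivial_solution[OF finM' finF' less, of "\<lambda>p x. kcoord (b p) x"]
    obtain u where u: "\<exists>p\<in>?A. u p \<noteq> 0" "\<forall>x\<in>?B. (\<Sum>p\<in>?A. u p * kcoord (b p) x) = 0" by blast
    define y where "y = (\<lambda>J. \<Sum>p\<in>?A. const (u p) * b p J)"
    have yM: "y \<in> ?M" unfolding y_def by (rule Mmod_lincomb) (rule conjunct1[OF b])
    have fy: "f y = (\<lambda>j. \<Sum>p\<in>?A. const (u p) * f (b p) j)"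
      unfolding y_def by (rule f_lin[OF finF' conjunct1[OF b]])
    have look: "lookup (f y j) m = (if (j, m) \<in> ?A then u (j, m) else 0)" for j m
    proof -
      have "lookup (f y j) m = (\<Sum>p\<in>?A. if p = (j, m) then u p else 0)"
        unfolding fy lookup_sum lookup_const_mult
      proof (rule sum.cong[OF refl])
        fix p assume "p \<in> ?A"
        from conjunct2[OF b[OF this]] show "u p * lookup (f (b p) j) m = (if p = (j, m) then u p else 0)"
          by (cases p) (auto simp: unit_def lookup_single when_def)
      qed
      also have "\<dots> = (if (j, m) \<in> ?A then u (j, m) else 0)" by (rule sum.delta[OF finF'])
      finally show ?thesis .
    qed
    have "homD g D d (f y)"
      unfolding homD_def homog_sh_def
    proof (intro allI impI ballI)
      fix j m assume "m \<in> keys (f y j)"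
      then have "(j, m) \<in> ?A" using look[of j m] by (metis in_keys_iff)
      then show "g m + snd (D ! j) = d" by (simp add: dF_def)
    qed
    then have hM': "homM g e d y" using f_hom[OF yM] by simp
    have "y = (\<lambda>I. 0)"
    proof (rule Mmod_eqI[OF yM Mmod_0 k(1)])
      fix x assume x: "x \<in> kbasis n k"
      have "kcoord y x = 0"
      proof (cases "x \<in> ?B")
        case True
        then show ?thesis using u(2) unfolding y_def kcoord_lincomb by blast
      next
        case False
        obtain I m where "x = (I, m)" by (cases x)
        then show ?thesis
          using hM'[unfolded homM_iff_kcoord[OF comp yM k(1)]] x False by (auto simp: dM_def)
      qed
      then show "kcoord y x = kcoord (\<lambda>I. 0) x" by (simp add: kcoord_def)
    qed
    then have fy0: "f y = (\<lambda>i. 0)" using f_zero by simp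
    have "u p = 0" if "p \<in> ?A" for p
    proof -
      obtain j m where "p = (j, m)" by (cases p)
      then show ?thesis using look[of j m] that by (simp only: fy0 lookup_zero if_True)
    qed
    with u(1) show False by blast
  qed
  have fib: "card {x \<in> kbasis n k. dM x = d} = card {y \<in> ?N. dF y = d}" for d
    using le1[of d] le2[of d] by (rule antisym)
  from fiberwise_bij[OF finM' finF' fib] obtain \<beta> where \<beta>: "bij_betw \<beta> (kbasis n k) ?N"
    and "\<forall>x\<in>kbasis n k. dF (\<beta> x) = dM x"
    by (elim exE conjE)
  note \<beta>_deg = bspec[OF this(2)]
  have card_eq: "card {x \<in> kbasis n k. h (dM x) = t} = card {y \<in> ?N. h (dF y) = t}" for t
  proof (rule bij_betw_same_card[of \<beta>], unfold bij_betw_def, intro conjI)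
    show "inj_on \<beta> {x \<in> kbasis n k. h (dM x) = t}"
      by (rule inj_on_subset[OF bij_betw_imp_inj_on[OF \<beta>]]) auto
    have "\<beta> ` {x \<in> kbasis n k. h (dM x) = t} = {y \<in> \<beta> ` kbasis n k. h (dF y) = t}"
      using \<beta>_deg by force
    then show "\<beta> ` {x \<in> kbasis n k. h (dM x) = t} = {y \<in> ?N. h (dF y) = t}"
      unfolding bij_betw_imp_surj_on[OF \<beta>] .
  qed
  \<comment> \<open>The generator of each summand corresponds to a basis element of the module, and
    those have degree at least \<open>k\<close>.\<close>
  have low: "int k \<le> h (snd (D ! j))" if "j < length D" for j
  proof -
    have N: "(j, 0) \<in> ?N" using that by simp
    then obtain x where x: "x \<in> kbasis n k" "\<beta> x = (j, 0)"
      using bij_betw_imp_surj_on[OF \<beta>] by (metis imageE)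
    obtain I m where Im: "x = (I, m)" by (cases x)
    have "h (dF (j, 0)) = h (dM (I, m))" using \<beta>_deg[OF x(1)] x Im by simp
    then show ?thesis using hF[OF N] hM[of I m] x Im by simp
  qed
  define T where "T = {j. j < length D \<and> h (snd (D ! j)) = int k}"
  let ?vars = "(\<lambda>i. single i 1) ` {..<n} :: (nat \<Rightarrow>\<^sub>0 nat) set"
  have "{y \<in> ?N. h (dF y) = int k} = T \<times> {0}"
  proof (intro equalityI subsetI)
    fix y assume y: "y \<in> {y \<in> ?N. h (dF y) = int k}"
    obtain j m where jm: "y = (j, m)" by (cases y)
    then have "(j, m) \<in> ?N" "h (dF (j, m)) = int k" using y by auto
    then have "h (snd (D ! j)) = int k" "tdeg m = 0" "j < length D" using hF[of j m] low[of j] by auto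
    then show "y \<in> T \<times> {0}" by (simp add: jm T_def tdeg_eq_0_iff)
  next
    fix y :: "nat \<times> (nat \<Rightarrow>\<^sub>0 nat)" assume "y \<in> T \<times> {0}"
    then show "y \<in> {y \<in> ?N. h (dF y) = int k}" using hF[of "fst y" 0] by (auto simp: T_def)
  qed
  moreover have "{x \<in> kbasis n k. h (dM x) = int k} = ksubs n k \<times> {0}"
  proof (intro equalityI subsetI)
    fix x assume x: "x \<in> {x \<in> kbasis n k. h (dM x) = int k}"
    obtain I m where Im: "x = (I, m)" by (cases x)
    then have "(I, m) \<in> kbasis n k" "h (dM (I, m)) = int k" using x by auto
    then have "tdeg m = 0" "I \<in> ksubs n k" using hM[of I m] by (auto simp: kbasis_def)
    then show "x \<in> ksubs n k \<times> {0}" by (simp add: Im tdeg_eq_0_iff)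
  next
    fix x :: "nat set \<times> (nat \<Rightarrow>\<^sub>0 nat)" assume "x \<in> ksubs n k \<times> {0}"
    then have "x \<in> kbasis n k" "x = (fst x, 0)" by (auto simp: kbasis_def)
    then show "x \<in> {x \<in> kbasis n k. h (dM x) = int k}" using hM[of "fst x" 0] by simp
  qed
  ultimately have cardT: "card T = card (ksubs n k)"
    using card_eq[of "int k"] by (simp add: card_cartesian_product)
  have "T \<times> ?vars \<subseteq> {y \<in> ?N. h (dF y) = int k + 1}"
  proof
    fix y assume "y \<in> T \<times> ?vars"
    then obtain j i where y: "y = (j, single i 1)" "j \<in> T" "i < n" by auto
    then have N: "y \<in> ?N" and "h (snd (D ! j)) = int k" by (auto simp: T_def)
    then have "h (dF y) = int k + 1" using hF[OF N[unfolded y(1)]] y(1) by simp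
    with N show "y \<in> {y \<in> ?N. h (dF y) = int k + 1}" by simp
  qed
  then have "card (T \<times> ?vars) \<le> card {y \<in> ?N. h (dF y) = int k + 1}" by (intro card_mono finF)
  also have "\<dots> = card {x \<in> kbasis n k. h (dM x) = int k + 1}" by (simp only: card_eq)
  also have "\<dots> < card (ksubs n k \<times> ?vars)"
  proof (rule psubset_card_mono)
    show "finite (ksubs n k \<times> ?vars)" using finite_ksubs by auto
    have "{x \<in> kbasis n k. h (dM x) = int k + 1} \<subseteq> ksubs n k \<times> ?vars"
    proof
      fix z assume z: "z \<in> {x \<in> kbasis n k. h (dM x) = int k + 1}"
      obtain I m where Im: "z = (I, m)" by (cases z)
      then have x: "(I, m) \<in> kbasis n k" "h (dM (I, m)) = int k + 1" using z by auto
      then have "tdeg m = 1" using hM[OF x(1)] by simp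
      then obtain i where i: "m = single i 1" using tdeg_eq_1 by blast
      then have "i < n" using kbasisD(6)[OF x(1) k(1)] by simp
      then show "z \<in> ksubs n k \<times> ?vars" using x(1) i by (auto simp: Im kbasis_def)
    qed
    \<comment> \<open>The pair that makes the inclusion strict: the \<open>k\<close> largest indices
      with the variable of index 0. As \<open>k < n\<close>, the least index \<open>n - k\<close>
      exceeds 0, so this is no basis index.\<close>
    moreover have "({n - k..<n}, single 0 1) \<in> ksubs n k \<times> ?vars" using k by (auto simp: ksubs_def)
    moreover have "({n - k..<n}, single 0 1) \<notin> kbasis n k"
    proof
      assume "({n - k..<n}, single 0 1) \<in> kbasis n k"
      note B = kbasisD[OF this k(1)]
      have "Min {n - k..<n} = 0" using B(5) by simp
      with B(4) k show False by simp
    qed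
    ultimately show "{x \<in> kbasis n k. h (dM x) = int k + 1} \<subset> ksubs n k \<times> ?vars" by blast
  qed
  also have "\<dots> = card (T \<times> ?vars)" by (simp add: card_cartesian_product cardT)
  finally show False by simp
qed

text \<open>An abstract grading covers both cases. \<open>lin\<close> is what forces kernel elements
  of a retraction to be linear forms, and \<open>h\<close> recovers the total degree for the finite
  counts.\<close>

lemma Hdepth_Mmod:
  fixes g :: "(nat \<Rightarrow>\<^sub>0 nat) \<Rightarrow> 'd::monoid_add" and h :: "'d \<Rightarrow> int"
  assumes comp: "compatible g e" and k: "1 \<le> k" "n div 2 \<le> k" "k < n"
    and Deg: "\<And>B. B \<subseteq> {..<n} \<Longrightarrow> e B \<in> Deg"
    and lin: "\<And>m i. g m = g (single i 1) \<Longrightarrow> \<exists>j. m = single j 1"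
    and h: "\<And>m s. keys m \<subseteq> {..<n} \<Longrightarrow> h (g m + s) = int (tdeg m) + h s"
    and he: "\<And>I. I \<subseteq> {..<n} \<Longrightarrow> h (e I) = int (card I)"
  shows "Hdepth g e Deg n (Mmod n k :: (nat set \<Rightarrow> ('k::field) mpoly) set) = n - 1"
proof -
  let ?M = "Mmod n k :: (nat set \<Rightarrow> 'k mpoly) set"
  have upper: "decomp_depth D \<le> n - 1" if D: "hilbert_decomp g e Deg n ?M D" for D
  proof (rule ccontr)
    assume "\<not> decomp_depth D \<le> n - 1"
    then have less: "n - 1 < Min ((\<lambda>(S, s). krull_dim S) ` set D)" by (simp add: decomp_depth_def)
    obtain f where f: "graded_iso g e ?M D f" using D by (auto simp: hilbert_decomp_def)
    have "fst (D ! j) = polyR n" if "j < length D" for j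
    proof (rule ccontr)
      assume ne: "fst (D ! j) \<noteq> polyR n"
      have mem: "D ! j \<in> set D" using that by simp
      then have "graded_retract g n (fst (D ! j))" using D by (auto simp: hilbert_decomp_def)
      from krull_dim_proper_retract[OF this ne lin] have "krull_dim (fst (D ! j)) \<le> n - 1" .
      moreover have "Min ((\<lambda>(S, s). krull_dim S) ` set D) \<le> krull_dim (fst (D ! j))"
        by (rule Min_le) (use mem in \<open>auto simp: case_prod_unfold\<close>)
      ultimately show False using less by simp
    qed
    from no_free_decomposition[OF comp k(1,3) h he this] f show False by blast
  qed
  obtain D where D: "hilbert_decomp g e Deg n ?M D" "D \<noteq> []"
      "\<And>S s. (S, s) \<in> set D \<Longrightarrow> n - 1 \<le> krull_dim S"
    using ex_hilbert_decomp[OF comp k Deg] by blast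
  have "n - 1 \<le> decomp_depth D" unfolding decomp_depth_def
    using D(2,3) by (intro Min.boundedI) auto
  then have "decomp_depth D = n - 1" using upper[OF D(1)] by simp
  then show ?thesis unfolding Hdepth_def
    using D(1) upper by (intro Greatest_equality) auto
qed

section \<open>The two gradings\<close>

lemma mdeg_std_eq_tdeg: "mdeg_std m = int (tdeg m)"
  by (simp add: mdeg_std_def tdeg_def)

lemma lookup_mdeg_multi: "lookup (mdeg_multi m) i = int (lookup m i)"
  by (simp add: mdeg_multi_def Poly_Mapping.map.rep_eq when_def)

lemma lookup_edeg_multi: "finite I \<Longrightarrow> lookup (edeg_multi I) i = (if i \<in> I then 1 else 0)"
  by (simp add: edeg_multi_def lookup_sum lookup_single when_def)

theorem theorem3p5:
  fixes n k :: nat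
  assumes "1 \<le> k" and "n div 2 \<le> k" and "k < n"
  shows "Hdepth_std n (Mmod n k :: (nat set \<Rightarrow> ('k::field) mpoly) set) = n - 1
       \<and> Hdepth_multi n (Mmod n k :: (nat set \<Rightarrow> 'k mpoly) set) = n - 1"
proof
  show "Hdepth_std n (Mmod n k :: (nat set \<Rightarrow> 'k mpoly) set) = n - 1"
  proof (rule Hdepth_Mmod[where h = "\<lambda>t. t", OF _ assms])
    show "compatible mdeg_std edeg_std"
      by (simp add: compatible_def mdeg_std_eq_tdeg edeg_std_def tdeg_add)
    show "\<exists>j. m = single j 1" if "mdeg_std m = mdeg_std (single i 1)" for m i
      using that tdeg_eq_1[of m] by (simp add: mdeg_std_eq_tdeg)
  qed (auto simp: mdeg_std_eq_tdeg edeg_std_def degs_std_def)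
  show "Hdepth_multi n (Mmod n k :: (nat set \<Rightarrow> 'k mpoly) set) = n - 1"
  \<comment> \<open>Summing the entries of a multidegree gives the total degree, as all variables in
    play have index below \<open>n\<close>.\<close>
  proof (rule Hdepth_Mmod[where h = "\<lambda>a. \<Sum>i<n. lookup a i", OF _ assms])
    show "compatible mdeg_multi edeg_multi"
      unfolding compatible_def
      by (intro allI impI poly_mapping_eqI)
        (auto simp: lookup_add lookup_mdeg_multi lookup_edeg_multi lookup_single when_def)
    show "\<exists>j. m = single j 1" if "mdeg_multi m = mdeg_multi (single i 1)" for m i
    proof -
      have "m = single i 1"
        using arg_cong[OF that, of "\<lambda>a. lookup a _"]
        by (intro poly_mapping_eqI) (simp add: lookup_mdeg_multi)
      then show ?thesis by blast
    qed
    show "edeg_multi B \<in> degs_multi n" if "B \<subseteq> {..<n}" for B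
    proof -
      have "finite B" using that finite_subset by blast
      then show ?thesis
        using that by (auto simp: degs_multi_def in_keys_iff lookup_edeg_multi split: if_splits)
    qed
    show "(\<Sum>i<n. lookup (mdeg_multi m + s) i) = int (tdeg m) + (\<Sum>i<n. lookup s i)"
      if "keys m \<subseteq> {..<n}" for m s
      using tdeg_superset[OF _ that] by (simp add: lookup_add lookup_mdeg_multi sum.distrib)
    show "(\<Sum>i<n. lookup (edeg_multi I) i) = int (card I)" if "I \<subseteq> {..<n}" for I
    proof -
      have "finite I" using that finite_subset by blast
      then have "(\<Sum>i<n. lookup (edeg_multi I) i) = (\<Sum>i\<in>{..<n} \<inter> I. 1)"
        by (simp only: lookup_edeg_multi sum.inter_restrict[OF finite_lessThan])
      then show ?thesis using that by (simp add: Int_absorb1)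
    qed
  qed
qed

end
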